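(* Let $E\subset\mathbb{C}\setminus\{0\}$ with $0\in\overline{E}$, and for $\varepsilon\in E$ let $S_\varepsilon=\{a_1^\varepsilon,a_2^\varepsilon,a_3^\varepsilon\}\subset\mathbb{D}^2$ with $$a_1^\varepsilon=(0,0),\quad a_2^\varepsilon=(\varepsilon,0),\quad a_3^\varepsilon=(\rho(\varepsilon),\delta(\varepsilon)\rho(\varepsilon)),\qquad \rho(\varepsilon)\ne0,$$ be three distinct points such that $\|a_3^\varepsilon\|\le\|a_3^\varepsilon-a_2^\varepsilon\|\le|\varepsilon|$, $\delta(\varepsilon)\to0$ and $\left|\dfrac{\delta(\varepsilon)}{\varepsilon}\right|\to\infty$ as $\varepsilon\to0$. Let $G_\varepsilon$ be the pluricomplex Green function of $\mathbb{D}^2$ with poles $S_\varepsilon$. If $$\frac{\log|\delta(\varepsilon)|}{\log|\varepsilon|}\longrightarrow0\quad\text{as }\varepsilon\to0,$$ then for any $z=(z_1,z_2)\in\mathbb{D}^2\setminus\{(0,0)\}$, $$\limsup_{\varepsilon\to0}G_\varepsilon(z)\ \le\ \tfrac32\log\max(|z_1|,|z_2|).$$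
   Context: $\mathbb{D}$ is the open unit disk in $\mathbb{C}$ and $\|\cdot\|$ the Euclidean norm on $\mathbb{C}^2$. $PSH_-(\mathbb{D}^2)$ is the set of nonpositive plurisubharmonic functions on $\mathbb{D}^2$. For a finite set $S\subset\mathbb{D}^2$, the pluricomplex Green function with (logarithmic) poles $S$ is $$G_S(z)=\sup\{u(z):\ u\in PSH_-(\mathbb{D}^2),\ u(w)\le\log\|w-a\|+O(1)\text{ as }w\to a,\ \text{for every } a\in S\};$$ this coincides with the Green function of the ideal of holomorphic functions vanishing on $S$. $G_\varepsilon:=G_{S_\varepsilon}$. *)

theory Defs
  imports "HOL-Analysis.Analysis"
begin

definition usc_on :: "'a::topological_space set \<Rightarrow> ('a \<Rightarrow> ereal) \<Rightarrow> bool" where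
  "usc_on \<Omega> u \<longleftrightarrow> (\<forall>t. openin (top_of_set \<Omega>) {x \<in> \<Omega>. u x < t})"

(* Mean value over the circle of centre c and radius r, as the difference of the integrals of the
   positive and negative parts (e2ennreal sends negative values to 0). If v is upper semicontinuous
   and < \<infinity> on the circle, it is bounded above there, so the first integral is finite and
   the mean lies in [-\<infinity>, \<infinity>). *)
definition circle_mean :: "(complex \<Rightarrow> ereal) \<Rightarrow> complex \<Rightarrow> real \<Rightarrow> ereal" where
  "circle_mean v c r =
     (enn2ereal (\<integral>\<^sup>+\<theta>\<in>{0..2*pi}. e2ennreal (v (c + of_real r * cis \<theta>)) \<partial>lborel)
      - enn2ereal (\<integral>\<^sup>+\<theta>\<in>{0..2*pi}. e2ennreal (- v (c + of_real r * cis \<theta>)) \<partial>lborel))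
     / ereal (2 * pi)"

(* The constant -\<infinity> is admitted as a subharmonic function. *)
definition subharmonic_on :: "complex set \<Rightarrow> (complex \<Rightarrow> ereal) \<Rightarrow> bool" where
  "subharmonic_on U v \<longleftrightarrow>
     open U \<and> usc_on U v \<and> (\<forall>c\<in>U. v c < \<infinity>) \<and>
     (\<forall>c r. 0 < r \<and> cball c r \<subseteq> U \<longrightarrow> v c \<le> circle_mean v c r)"

(* Only the values on \<Omega> matter. The complex line through p in direction q is parametrised by
   \<zeta> \<mapsto> p + \<zeta> q; the constant -\<infinity> is admitted. *)
definition plurisubharmonic_on ::
    "(complex \<times> complex) set \<Rightarrow> (complex \<times> complex \<Rightarrow> ereal) \<Rightarrow> bool" where
  "plurisubharmonic_on \<Omega> u \<longleftrightarrow>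
     open \<Omega> \<and> usc_on \<Omega> u \<and> (\<forall>z\<in>\<Omega>. u z < \<infinity>) \<and>
     (\<forall>p q. subharmonic_on {\<zeta>. (fst p + \<zeta> * fst q, snd p + \<zeta> * snd q) \<in> \<Omega>}
              (\<lambda>\<zeta>. u (fst p + \<zeta> * fst q, snd p + \<zeta> * snd q)))"

definition psh_nonpos :: "(complex \<times> complex) set \<Rightarrow> (complex \<times> complex \<Rightarrow> ereal) set" where
  "psh_nonpos \<Omega> = {u. plurisubharmonic_on \<Omega> u \<and> (\<forall>z\<in>\<Omega>. u z \<le> 0)}"

(* u(w) \<le> log \<parallel>w - a\<parallel> + O(1) as w \<rightarrow> a. The norm on pairs is the Euclidean one. The filter "at a"
   omits w = a, where the library's convention ln 0 = 0 would give the wrong bound. *)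
definition log_pole :: "(complex \<times> complex \<Rightarrow> ereal) \<Rightarrow> complex \<times> complex \<Rightarrow> bool" where
  "log_pole u a \<longleftrightarrow> (\<exists>C::real. \<forall>\<^sub>F w in at a. u w \<le> ereal (ln (norm (w - a)) + C))"

definition pluricomplex_green ::
    "(complex \<times> complex) set \<Rightarrow> (complex \<times> complex) set \<Rightarrow> complex \<times> complex \<Rightarrow> ereal" where
  "pluricomplex_green \<Omega> S z =
     (SUP u \<in> {u \<in> psh_nonpos \<Omega>. \<forall>a\<in>S. log_pole u a}. u z)"

definition bidisk :: "(complex \<times> complex) set" where
  "bidisk = ball 0 1 \<times> ball 0 1"

end

theory Submission
  imports Defs "HOL-Complex_Analysis.Complex_Analysis"
begin

text \<open>
  An upper bound for a Green function comes from any analytic disc through the poles: if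
  \<open>\<phi> = (f, g)\<close> maps the closed disc of radius \<open>R\<close> into the bidisk, hits the poles at parameters \<open>a\<close> with
  \<open>|a| \<le> \<eta>\<close> and \<open>u\<close> is a competitor for the Green function, then the maximum principle for
  \<open>u (\<phi> \<zeta>) - (\<Sum>a. ln (|\<zeta> - a| / (R - \<eta>)))\<close> shows that this difference is nonpositive
  (\<open>psh_le_log_sum_on_disc\<close>). For discs with \<open>\<phi> 1 = (z\<^sub>1, z\<^sub>2)\<close> and three pole parameters that tend to 0, the
  bound becomes \<open>-3 ln R\<close> (\<open>Limsup_green_le_of_discs\<close>).

  If \<open>z\<^sub>2 \<noteq> 0\<close>, the discs are parabolas. A parabola through the first two poles and \<open>(z\<^sub>1, z\<^sub>2)\<close> has one free
  complex parameter \<open>s\<close>; passing through the third pole is a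
  quadratic equation for \<open>s\<close>. The curvature needed to reach that pole is of size \<open>|\<delta>/\<epsilon>|\<close>. As it tends to
  infinity, \<open>s\<close> and all pole parameters tend to 0, and the parabolas degenerate to the doubly covered disc
  \<open>\<zeta> \<mapsto> \<zeta>\<^sup>2 (z\<^sub>1, z\<^sub>2)\<close> (\<open>quadratic_root_asymptotics\<close>). It stays in the bidisk for every \<open>R\<close> with
  \<open>R\<^sup>2 max (|z\<^sub>1|, |z\<^sub>2|) < 1\<close>, and \<open>-3 ln R\<close> tends to the asserted bound as \<open>R\<close> grows to its limit. If \<open>z\<^sub>2 = 0\<close>,
  the axis contains two poles and gives \<open>2 ln |z\<^sub>1|\<close>, which is smaller.

  Plurisubharmonicity is a condition on complex lines only, so the maximum principle on curved discs
  needs an argument. It is proved by doubling the variables, as for viscosity solutions: the point \<open>w\<close>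
  of the bidisk is separated from \<open>\<phi> \<zeta>\<close> and tied to it by a penalty \<open>N |w - \<phi> \<zeta>|\<^sup>2\<close>. At an interior maximum
  it suffices to move \<open>w\<close> along the tangent line of the disc, which changes the penalty only to fourth
  order in the mean (\<open>psh_strictly_below_penalised_disc\<close>).
\<close>

section \<open>Comparison with harmonic functions on circles\<close>

lemma has_integral_circle_holomorphic:
  assumes f: "f holomorphic_on A" and A: "open A" "cball c r \<subseteq> A" and r: "0 < r"
  shows "((\<lambda>\<theta>. f (c + of_real r * cis \<theta>)) has_integral of_real (2 * pi) * f c) {0..2*pi}"
proof -
  have "((\<lambda>u. f u/(u-c)) has_contour_integral (2 * of_real pi * \<i> * f c)) (circlepath c r)"
    using holomorphic_on_subset[OF f A(2)] r by (intro Cauchy_integral_circlepath_simple) auto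
  then have "((\<lambda>t. f (c + r * cis t) / (c + r * cis t - c) * r * \<i> * cis t) has_integral 2 * of_real pi * \<i> * f c) {0..2*pi}"
    unfolding circlepath_def by (subst (asm) has_contour_integral_part_circlepath_iff) auto
  then have "((\<lambda>t. (f (c + r * cis t) / (c + r * cis t - c) * r * \<i> * cis t) / \<i>) has_integral 2 * of_real pi * \<i> * f c / \<i>) {0..2*pi}"
    by (rule has_integral_divide)
  moreover have "f (c + r * cis t) / (c + r * cis t - c) * r * \<i> * cis t / \<i> = f (c + r * cis t)" for t
    using r by (simp add: field_simps)
  moreover have "2 * of_real pi * \<i> * f c / \<i> = of_real (2 * pi) * f c"
    by (simp add: field_simps)
  ultimately show ?thesis
    by (simp only:)
qed

text \<open>Both integrals in the definition of the mean are monotone for arbitrary functions, which spares a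
  discussion of measurability.\<close>
lemma circle_mean_le_integral:
  assumes k: "continuous_on {0..2*pi} k" and I: "(k has_integral I) {0..2*pi}"
    and le: "\<And>\<theta>. \<theta> \<in> {0..2*pi} \<Longrightarrow> v (c + of_real r * cis \<theta>) \<le> ereal (k \<theta>)"
  shows "circle_mean v c r \<le> ereal (I / (2 * pi))"
proof -
  define k' where "k' \<theta> = indicator {0..2*pi} \<theta> * k \<theta>" for \<theta> :: real
  let ?P = "\<integral>\<^sup>+\<theta>. ennreal (k' \<theta>) \<partial>lborel" and ?N = "\<integral>\<^sup>+\<theta>. ennreal (- k' \<theta>) \<partial>lborel"
  have si: "set_integrable lborel {0..2*pi} k"
    using k borel_integrable_compact[OF _ k] by (simp add: set_integrable_def)
  then have int: "integrable lborel k'"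
    by (simp add: set_integrable_def k'_def[abs_def])
  have "I = integral {0..2*pi} k"
    using I by (simp add: integral_unique)
  also have "\<dots> = (LINT \<theta>|lborel. k' \<theta>)"
    using set_borel_integral_eq_integral(2)[OF si] by (simp add: set_lebesgue_integral_def k'_def)
  also have "\<dots> = enn2real ?P - enn2real ?N"
    using int by (rule real_lebesgue_integral_def)
  finally have I_eq: "I = enn2real ?P - enn2real ?N" .
  have fin: "?P < \<infinity>" "?N < \<infinity>"
    using int by (auto simp: real_integrable_def less_top)
  have "enn2ereal x = ereal (enn2real x)" if "x < \<infinity>" for x
    using that by (cases x) auto
  with fin I_eq have "ereal I = enn2ereal ?P - enn2ereal ?N"
    by simp
  moreover have "(\<integral>\<^sup>+\<theta>\<in>{0..2*pi}. e2ennreal (v (c + of_real r * cis \<theta>)) \<partial>lborel) \<le> ?P"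
  proof (rule nn_integral_mono)
    fix \<theta>
    show "e2ennreal (v (c + of_real r * cis \<theta>)) * indicator {0..2*pi} \<theta> \<le> ennreal (k' \<theta>)"
      using e2ennreal_mono[OF le[of \<theta>]] by (auto simp: k'_def indicator_def)
  qed
  moreover have "?N \<le> (\<integral>\<^sup>+\<theta>\<in>{0..2*pi}. e2ennreal (- v (c + of_real r * cis \<theta>)) \<partial>lborel)"
  proof (rule nn_integral_mono)
    fix \<theta>
    show "ennreal (- k' \<theta>) \<le> e2ennreal (- v (c + of_real r * cis \<theta>)) * indicator {0..2*pi} \<theta>"
    proof (cases "\<theta> \<in> {0..2*pi}")
      case True
      then have "ereal (- k \<theta>) \<le> - v (c + of_real r * cis \<theta>)"
        using le[of \<theta>] by (simp flip: uminus_ereal.simps)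
      from e2ennreal_mono[OF this] True show ?thesis
        by (simp add: k'_def)
    qed (simp add: k'_def)
  qed
  ultimately have "enn2ereal (\<integral>\<^sup>+\<theta>\<in>{0..2*pi}. e2ennreal (v (c + of_real r * cis \<theta>)) \<partial>lborel)
      - enn2ereal (\<integral>\<^sup>+\<theta>\<in>{0..2*pi}. e2ennreal (- v (c + of_real r * cis \<theta>)) \<partial>lborel) \<le> ereal I"
    by (simp only: less_eq_ennreal.rep_eq ereal_minus_mono)
  then have "circle_mean v c r \<le> ereal I / ereal (2 * pi)"
    unfolding circle_mean_def by (intro ereal_divide_right_mono) auto
  then show ?thesis by simp
qed

text \<open>The one consequence of subharmonicity on which everything rests. Because the mean value of the
  real part of a holomorphic function is its value at the centre, no integral occurs from here on.\<close>
lemma subharmonic_le_Re_holomorphic: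
  assumes v: "subharmonic_on U v" and U: "cball c r \<subseteq> U" and r: "0 < r"
    and f: "f holomorphic_on A" and A: "open A" "cball c r \<subseteq> A"
    and le: "\<And>\<zeta>. cmod (\<zeta> - c) = r \<Longrightarrow> v \<zeta> \<le> ereal (Re (f \<zeta>) + K)"
  shows "v c \<le> ereal (Re (f c) + K)"
proof -
  let ?k = "\<lambda>\<theta>. Re (f (c + of_real r * cis \<theta>)) + K"
  have "v c \<le> circle_mean v c r"
    using v U r by (auto simp: subharmonic_on_def)
  also have "\<dots> \<le> ereal ((2 * pi * (Re (f c) + K)) / (2 * pi))"
  proof (rule circle_mean_le_integral[where k = ?k])
    have "(\<lambda>\<theta>. c + of_real r * cis \<theta>) ` {0..2*pi} \<subseteq> A"
      using r A by (auto simp: dist_norm norm_mult subset_iff)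
    then show "continuous_on {0..2*pi} ?k"
      by (intro continuous_intros continuous_on_compose2[OF holomorphic_on_imp_continuous_on[OF f]])
    show "(?k has_integral (2 * pi * (Re (f c) + K))) {0..2*pi}"
      using has_integral_add[OF has_integral_Re[OF has_integral_circle_holomorphic[OF f A r]]
          has_integral_const_real[of K 0 "2*pi"]]
      by (simp add: algebra_simps)
    show "v (c + of_real r * cis \<theta>) \<le> ereal (?k \<theta>)" for \<theta>
      using r by (intro le) (simp add: norm_mult)
  qed
  finally show ?thesis by simp
qed

section \<open>Maxima of upper semicontinuous functions\<close>

lemma usc_on_attains_sup:
  assumes "usc_on K F" "compact K" "K \<noteq> {}"
  shows "\<exists>x\<in>K. \<forall>y\<in>K. F y \<le> F x"
proof (rule ccontr)
  assume neg: "\<not> ?thesis"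
  have "\<forall>y. \<exists>T. open T \<and> {x \<in> K. F x < F y} = K \<inter> T"
    using assms(1) by (auto simp: usc_on_def openin_open)
  then obtain T where T: "\<And>y. open (T y)" "\<And>y. {x \<in> K. F x < F y} = K \<inter> T y"
    by metis
  have "K \<subseteq> (\<Union>y\<in>K. T y)"
  proof
    fix x assume "x \<in> K"
    with neg obtain y where "y \<in> K" "F x < F y" by (meson not_le)
    with T(2)[of y] \<open>x \<in> K\<close> show "x \<in> (\<Union>y\<in>K. T y)" by auto
  qed
  then obtain D where D: "D \<subseteq> K" "finite D" "K \<subseteq> (\<Union>y\<in>D. T y)"
    using compactE_image[OF assms(2), of K T] T(1) by metis
  with assms(3) have "D \<noteq> {}" by auto
  with D obtain y where y: "y \<in> D" "\<And>x. x \<in> D \<Longrightarrow> F x \<le> F y"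
    using Max_in[of "F ` D"] Max_ge[of "F ` D"] by (metis (no_types, lifting) finite_imageI image_iff image_is_empty)
  from y D obtain x where "x \<in> D" "y \<in> T x" by auto
  with T(2)[of x] y D have "F y < F x" by auto
  with y(2)[OF \<open>x \<in> D\<close>] show False by simp
qed

text \<open>Written with sublevel sets because addition of extended reals is not continuous: the sum is below
  \<open>t\<close> exactly if some real \<open>\<alpha>\<close> separates \<open>u (p x)\<close> from \<open>t - h x\<close>, and each such condition is open.\<close>
lemma usc_on_comp_add_continuous:
  fixes u :: "'b::topological_space \<Rightarrow> ereal" and h :: "'a::topological_space \<Rightarrow> real"
  assumes u: "usc_on \<Omega> u" and \<Omega>: "open \<Omega>" and p: "continuous_on K p" "p ` K \<subseteq> \<Omega>"
    and h: "continuous_on K h" and fin: "\<And>w. w \<in> \<Omega> \<Longrightarrow> u w < \<infinity>"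
  shows "usc_on K (\<lambda>x. u (p x) + ereal (h x))"
  unfolding usc_on_def
proof
  fix t
  let ?S = "\<lambda>\<alpha>. {x \<in> K. p x \<in> {w \<in> \<Omega>. u w < ereal \<alpha>}} \<inter> {x \<in> K. ereal (h x + \<alpha>) < t}"
  have "{x \<in> K. u (p x) + ereal (h x) < t} = (\<Union>\<alpha>. ?S \<alpha>)"
  proof (intro set_eqI iffI)
    fix x assume "x \<in> {x \<in> K. u (p x) + ereal (h x) < t}"
    then have x: "x \<in> K" "u (p x) + ereal (h x) < t" by auto
    then have px: "p x \<in> \<Omega>" using p by auto
    have "u (p x) < t - ereal (h x)"
      using x(2) by (simp add: ereal_less_minus)
    then obtain \<alpha> where "u (p x) < \<alpha>" "\<alpha> < t - ereal (h x)"
      using dense by blast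
    moreover from this have "\<bar>\<alpha>\<bar> \<noteq> \<infinity>" by auto
    ultimately obtain a where "u (p x) < ereal a" "ereal a < t - ereal (h x)"
      by (metis ereal_real)
    then have "ereal (h x + a) < t"
      by (cases t) (auto simp: algebra_simps)
    then show "x \<in> (\<Union>\<alpha>. ?S \<alpha>)"
      using x px \<open>u (p x) < ereal a\<close> by auto
  next
    fix x assume "x \<in> (\<Union>\<alpha>. ?S \<alpha>)"
    then obtain \<alpha> where "x \<in> K" "u (p x) < ereal \<alpha>" "ereal (h x + \<alpha>) < t" by auto
    moreover have "u (p x) + ereal (h x) \<le> ereal \<alpha> + ereal (h x)"
      using calculation by (intro add_mono) auto
    ultimately show "x \<in> {x \<in> K. u (p x) + ereal (h x) < t}"
      by (auto simp: add.commute intro: le_less_trans)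
  qed
  moreover have "openin (top_of_set K) (?S \<alpha>)" for \<alpha>
  proof (rule openin_Int)
    have "open {w \<in> \<Omega>. u w < ereal \<alpha>}"
      using u \<Omega> openin_open_trans unfolding usc_on_def by blast
    then show "openin (top_of_set K) {x \<in> K. p x \<in> {w \<in> \<Omega>. u w < ereal \<alpha>}}"
      using continuous_openin_preimage_gen[OF p(1), of "{w \<in> \<Omega>. u w < ereal \<alpha>}"]
      by (simp only: vimage_def Int_def mem_Collect_eq)
    have "continuous_on K (\<lambda>x. ereal (h x + \<alpha>))"
      by (intro continuous_intros h)
    then show "openin (top_of_set K) {x \<in> K. ereal (h x + \<alpha>) < t}"
      using continuous_openin_preimage_gen[of K "\<lambda>x. ereal (h x + \<alpha>)" "{..<t}"]
      by (simp add: vimage_def Int_def)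
  qed
  then have "openin (top_of_set K) (\<Union>\<alpha>. ?S \<alpha>)"
    by (intro openin_Union) blast
  ultimately show "openin (top_of_set K) {x \<in> K. u (p x) + ereal (h x) < t}"
    by (simp only:)
qed

lemma psh_le_Re_holomorphic_on_line:
  assumes u: "plurisubharmonic_on \<Omega> u" and r: "0 < r"
    and line: "\<And>\<tau>. cmod \<tau> \<le> r \<Longrightarrow> (fst p + \<tau> * fst q, snd p + \<tau> * snd q) \<in> \<Omega>"
    and f: "f holomorphic_on A" and A: "open A" "cball 0 r \<subseteq> A"
    and le: "\<And>\<tau>. cmod \<tau> = r \<Longrightarrow> u (fst p + \<tau> * fst q, snd p + \<tau> * snd q) \<le> ereal (Re (f \<tau>) + K)"
  shows "u p \<le> ereal (Re (f 0) + K)"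
proof -
  have "subharmonic_on {\<zeta>. (fst p + \<zeta> * fst q, snd p + \<zeta> * snd q) \<in> \<Omega>}
          (\<lambda>\<zeta>. u (fst p + \<zeta> * fst q, snd p + \<zeta> * snd q))"
    using u by (simp add: plurisubharmonic_on_def)
  from subharmonic_le_Re_holomorphic[OF this _ r f A, where K = K] line le show ?thesis
    by (auto simp: subset_iff)
qed

section \<open>Behaviour near a logarithmic pole\<close>

text \<open>The definition of a logarithmic pole says nothing about the value at \<open>a\<close> itself, yet the tube
  around a disc can contain \<open>a\<close>. The sub-mean value inequality on small circles in a complex line
  through \<open>a\<close> provides the missing bound.\<close>
lemma log_pole_upper_bound:
  assumes u: "plurisubharmonic_on \<Omega> u" and a: "a \<in> \<Omega>" and pole: "log_pole u a"
  shows "\<exists>C. \<exists>d>0. \<forall>r w. 0 < r \<and> r < d \<and> norm (w - a) \<le> r \<longrightarrow> u w \<le> ereal (ln r + C)"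
proof -
  obtain C d1 where d1: "d1 > 0"
    "\<And>w. w \<noteq> a \<Longrightarrow> dist w a < d1 \<Longrightarrow> u w \<le> ereal (ln (norm (w - a)) + C)"
    using pole by (auto simp: log_pole_def eventually_at)
  have "open \<Omega>" using u by (simp add: plurisubharmonic_on_def)
  then obtain d2 where d2: "d2 > 0" "ball a d2 \<subseteq> \<Omega>"
    using a by (auto simp: open_contains_ball)
  have off: "u w \<le> ereal (ln r + C)" if "norm (w - a) \<le> r" "0 < r" "r < min d1 d2" "w \<noteq> a" for r w
  proof -
    have "u w \<le> ereal (ln (norm (w - a)) + C)"
      using that by (intro d1(2)) (auto simp: dist_norm)
    also have "\<dots> \<le> ereal (ln r + C)"
      using that by (simp add: ln_mono)
    finally show ?thesis .
  qed
  have centre: "u a \<le> ereal (ln r + C)" if r: "0 < r" "r < min d1 d2" for r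
  proof -
    have shift: "(fst a + \<tau> * 1, snd a + \<tau> * 0) - a = (\<tau>, 0)" for \<tau>
      by (simp add: prod_eq_iff)
    have "norm ((fst a + \<tau> * 1, snd a + \<tau> * 0) - a) = cmod \<tau>" for \<tau>
      unfolding shift by (simp add: norm_Pair)
    note nrm = this
    have "u a \<le> ereal (Re 0 + (ln r + C))"
    proof (rule psh_le_Re_holomorphic_on_line[OF u r(1), where q = "(1, 0)" and f = "\<lambda>_. 0" and A = UNIV])
      fix \<tau> :: complex
      show "(fst a + \<tau> * fst (1, 0), snd a + \<tau> * snd (1, 0)) \<in> \<Omega>" if "cmod \<tau> \<le> r"
        using that r d2(2) nrm[of \<tau>] by (auto simp: subset_iff dist_norm norm_minus_commute)
      assume \<tau>: "cmod \<tau> = r"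
      with r have "\<tau> \<noteq> 0" by auto
      then have "(fst a + \<tau> * 1, snd a + \<tau> * 0) \<noteq> a"
        by (simp add: prod_eq_iff)
      with off[of "(fst a + \<tau> * 1, snd a + \<tau> * 0)" r] nrm[of \<tau>] \<tau> r
      show "u (fst a + \<tau> * fst (1, 0), snd a + \<tau> * snd (1, 0)) \<le> ereal (Re 0 + (ln r + C))"
        by simp
    qed auto
    then show ?thesis by simp
  qed
  have "u w \<le> ereal (ln r + C)" if "0 < r" "r < min d1 d2" "norm (w - a) \<le> r" for r w
    using off centre that by (cases "w = a") auto
  moreover have "min d1 d2 > 0" using d1 d2 by simp
  ultimately show ?thesis by blast
qed

text \<open>Along a holomorphic disc that hits the pole at parameter \<open>a\<close>, \<open>u\<close> has a pole of strength at
  least 1 in \<open>\<zeta> - a\<close>, because \<open>w - (f a, g a)\<close> is of order \<open>\<zeta> - a\<close>; hence \<open>u\<close> lies, close to \<open>a\<close>, below any function with a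
  pole of strength \<open>1 - \<kappa>\<close>. Points \<open>w\<close> off the disc are allowed at a distance up to that between \<open>\<zeta>\<close> and
  \<open>a\<close>, which leaves room for the tube in which the maximum principle is applied.\<close>
lemma pole_dominated_by_weaker_pole:
  assumes u: "plurisubharmonic_on \<Omega> u" and pole: "log_pole u (f a, g a)" and a: "(f a, g a) \<in> \<Omega>"
    and f: "(f has_field_derivative f') (at a)" and g: "(g has_field_derivative g') (at a)"
    and L: "\<And>\<zeta>. \<zeta> \<noteq> a \<Longrightarrow> L \<zeta> = ln (cmod (\<zeta> - a)) + l \<zeta>" and l: "isCont l a"
    and \<kappa>: "0 < \<kappa>" "\<kappa> < 1"
  shows "\<forall>\<^sub>F s in at_right (0::real). \<forall>\<zeta> w. cmod (\<zeta> - a) = s \<longrightarrow> norm (w - (f \<zeta>, g \<zeta>)) \<le> s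
           \<longrightarrow> u w < ereal ((1 - \<kappa>) * L \<zeta>)"
proof -
  obtain C d where d: "d > 0"
    "\<forall>r w. 0 < r \<and> r < d \<and> norm (w - (f a, g a)) \<le> r \<longrightarrow> u w \<le> ereal (ln r + C)"
    using log_pole_upper_bound[OF u a pole] by blast
  define B where "B = cmod f' + cmod g' + 2"
  have B: "B \<ge> 2" by (simp add: B_def)
  have "\<forall>\<^sub>F \<zeta> in at a. cmod ((f \<zeta> - f a) / (\<zeta> - a)) < cmod f' + 1"
    by (rule order_tendstoD(2)[OF tendsto_norm[OF f[unfolded has_field_derivative_iff]]]) simp
  moreover have "\<forall>\<^sub>F \<zeta> in at a. cmod ((g \<zeta> - g a) / (\<zeta> - a)) < cmod g' + 1"
    by (rule order_tendstoD(2)[OF tendsto_norm[OF g[unfolded has_field_derivative_iff]]]) simp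
  moreover have "\<forall>\<^sub>F \<zeta> in at a. l \<zeta> > l a - 1"
    by (rule order_tendstoD(1)[OF l[unfolded isCont_def]]) simp
  ultimately have "\<forall>\<^sub>F \<zeta> in at a. norm ((f \<zeta>, g \<zeta>) - (f a, g a)) \<le> B * cmod (\<zeta> - a) \<and> l \<zeta> > l a - 1"
    using eventually_neq_at_within[of a]
  proof eventually_elim
    case (elim \<zeta>)
    then have "cmod (f \<zeta> - f a) \<le> (cmod f' + 1) * cmod (\<zeta> - a)"
      "cmod (g \<zeta> - g a) \<le> (cmod g' + 1) * cmod (\<zeta> - a)"
      by (auto simp: norm_divide field_simps)
    moreover have "norm ((f \<zeta>, g \<zeta>) - (f a, g a)) \<le> cmod (f \<zeta> - f a) + cmod (g \<zeta> - g a)"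
      using norm_Pair_le[of "f \<zeta> - f a" "g \<zeta> - g a"] by simp
    ultimately show ?case
      using elim by (simp add: B_def algebra_simps)
  qed
  then obtain d1 where d1: "d1 > 0"
    "\<And>\<zeta>. \<zeta> \<noteq> a \<Longrightarrow> dist \<zeta> a < d1 \<Longrightarrow>
       norm ((f \<zeta>, g \<zeta>) - (f a, g a)) \<le> B * cmod (\<zeta> - a) \<and> l \<zeta> > l a - 1"
    by (auto simp: eventually_at)
  define X where "X = ((1 - \<kappa>) * (l a - 1) - ln (B + 1) - C) / \<kappa>"
  have "\<forall>\<^sub>F s in at_right 0. ln s < X"
    using ln_at_0 by (simp add: filterlim_at_bot_dense)
  moreover have "\<forall>\<^sub>F s in at_right 0. s \<in> {0<..<min d1 (d / (B + 1))}"
    using d d1 B by (intro eventually_at_right_real) auto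
  ultimately show ?thesis
  proof eventually_elim
    case (elim s)
    then have s: "0 < s" "s < d1" "(B + 1) * s < d"
      using B by (auto simp: field_simps)
    show ?case
    proof (intro allI impI)
      fix \<zeta> w assume \<zeta>: "cmod (\<zeta> - a) = s" and w: "norm (w - (f \<zeta>, g \<zeta>)) \<le> s"
      then have ne: "\<zeta> \<noteq> a" using s by auto
      with d1(2)[of \<zeta>] \<zeta> s have near: "norm ((f \<zeta>, g \<zeta>) - (f a, g a)) \<le> B * s" "l \<zeta> > l a - 1"
        by (auto simp: dist_norm)
      have "norm (w - (f a, g a)) \<le> (B + 1) * s"
        using norm_diff_triangle_le[OF w near(1)] by (simp only: distrib_right add.commute mult_1)
      then have "u w \<le> ereal (ln ((B + 1) * s) + C)"
        using s B by (intro d(2)[rule_format]) auto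
      also have "ln ((B + 1) * s) + C = ln s + (ln (B + 1) + C)"
        using s B by (simp add: ln_mult)
      also have "\<dots> < (1 - \<kappa>) * (ln s + (l a - 1))"
        using elim(1) \<kappa> by (simp add: X_def field_simps)
      also have "\<dots> \<le> (1 - \<kappa>) * L \<zeta>"
        using L[OF ne] \<zeta> near \<kappa> by (intro mult_left_mono) auto
      finally show "u w < ereal ((1 - \<kappa>) * L \<zeta>)" by simp
    qed
  qed
qed

section \<open>The maximum principle along a holomorphic disc\<close>

lemma holomorphic_Taylor_remainder:
  assumes f: "f holomorphic_on A" "open A" "c \<in> A"
  obtains B where "\<forall>\<^sub>F \<tau> in nhds 0. cmod (f (c + \<tau>) - f c - \<tau> * deriv f c) \<le> B * (cmod \<tau>)\<^sup>2"
proof -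
  obtain d where d: "d > 0" "cball c d \<subseteq> A"
    using f by (auto simp: open_contains_cball)
  have hol: "(deriv ^^ i) f holomorphic_on A" for i
    using f by (intro holomorphic_higher_deriv)
  have "compact ((deriv ^^ 2) f ` cball c d)"
    using hol[of 2] d
    by (intro compact_continuous_image) (auto intro: holomorphic_on_imp_continuous_on holomorphic_on_subset)
  then obtain B where B: "\<And>z. z \<in> cball c d \<Longrightarrow> cmod ((deriv ^^ 2) f z) \<le> B"
    using compact_imp_bounded by (force simp: bounded_iff)
  have "cmod (f (c + \<tau>) - f c - \<tau> * deriv f c) \<le> B * (cmod \<tau>)\<^sup>2" if \<tau>: "cmod \<tau> < d" for \<tau>
  proof -
    have "norm ((deriv ^^ 0) f (c + \<tau>) - (\<Sum>i\<le>1. (deriv ^^ i) f c * (c + \<tau> - c) ^ i / fact i))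
          \<le> B * norm (c + \<tau> - c) ^ Suc 1 / fact 1"
    proof (rule field_Taylor[where S = "cball c d"])
      fix i x assume x: "x \<in> cball c d"
      then have "((deriv ^^ i) f has_field_derivative (deriv ^^ Suc i) f x) (at x)"
        using holomorphic_derivI[OF hol[of i] f(2)] d by auto
      then show "((deriv ^^ i) f has_field_derivative (deriv ^^ Suc i) f x) (at x within cball c d)"
        by (rule has_field_derivative_at_within)
    next
      show "norm ((deriv ^^ Suc 1) f x) \<le> B" if "x \<in> cball c d" for x
        using B[OF that] by (simp add: numeral_2_eq_2)
    qed (use d \<tau> in \<open>auto simp: dist_norm\<close>)
    then show ?thesis
      by (simp add: power2_eq_square algebra_simps)
  qed
  then show thesis
    using d by (intro that[of B]) (auto simp: eventually_nhds_metric)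
qed

lemma log_sum_locally_Re_holomorphic:
  assumes J: "finite J" "c \<notin> J" and r: "r > 0"
  shows "\<exists>H B. open B \<and> c \<in> B \<and> H holomorphic_on B
           \<and> (\<forall>\<zeta>\<in>B. (\<Sum>a\<in>J. ln (cmod (\<zeta> - a) / r)) = Re (H \<zeta>))"
proof -
  define B where "B = (\<Inter>a\<in>J. ball c (cmod (c - a)))"
  define H where "H \<zeta> = (\<Sum>a\<in>J. Ln ((\<zeta> - a) / (c - a)) + of_real (ln (cmod (c - a) / r)))" for \<zeta>
  have slit: "(\<zeta> - a) / (c - a) \<notin> \<real>\<^sub>\<le>\<^sub>0 \<and> \<zeta> \<noteq> a" if "\<zeta> \<in> B" "a \<in> J" for \<zeta> a
  proof -
    have "cmod (\<zeta> - c) < cmod (c - a)"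
      using that by (auto simp: B_def dist_norm norm_minus_commute)
    moreover have ca: "c \<noteq> a" using that J by auto
    ultimately have "cmod ((\<zeta> - c) / (c - a)) < 1"
      by (simp add: norm_divide)
    moreover have "(\<zeta> - a) / (c - a) = 1 + (\<zeta> - c) / (c - a)"
      using ca by (simp add: field_simps)
    ultimately have "Re ((\<zeta> - a) / (c - a)) > 0"
      using abs_Re_le_cmod[of "(\<zeta> - c) / (c - a)"] by simp
    then show ?thesis
      using complex_nonpos_Reals_iff by force
  qed
  show ?thesis
  proof (intro exI conjI ballI)
    show "open B" using J unfolding B_def by (intro open_INT) auto
    show "c \<in> B" using J by (auto simp: B_def)
    show "H holomorphic_on B"
      unfolding H_def using slit J by (intro holomorphic_intros) auto
    show "(\<Sum>a\<in>J. ln (cmod (\<zeta> - a) / r)) = Re (H \<zeta>)" if "\<zeta> \<in> B" for \<zeta>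
    proof -
      have "ln (cmod (\<zeta> - a) / r) = Re (Ln ((\<zeta> - a) / (c - a)) + of_real (ln (cmod (c - a) / r)))"
        if "a \<in> J" for a
      proof -
        have "\<zeta> - a \<noteq> 0" "c - a \<noteq> 0"
          using slit[OF \<open>\<zeta> \<in> B\<close> that] that J by auto
        then show ?thesis
          using r by (simp add: norm_divide ln_div)
      qed
      then show ?thesis by (simp add: H_def)
    qed
  qed
qed

lemma cmod_diff_squared: "(cmod (x - y))\<^sup>2 = (cmod x)\<^sup>2 - 2 * Re (cnj x * y) + (cmod y)\<^sup>2"
  unfolding cmod_power2 by (simp add: power2_eq_square algebra_simps)

lemma norm_prod_squared: "(norm p)\<^sup>2 = (cmod (fst p))\<^sup>2 + (cmod (snd p))\<^sup>2"
  by (simp add: norm_prod_def)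

text \<open>The core of the argument. Suppose that near \<open>w\<close>, along the complex line in the direction of the
  tangent of the disc \<open>\<phi> = (f, g)\<close> at \<open>c\<close>, the function \<open>u\<close> lies below a harmonic function plus
  \<open>N |w - \<phi> \<zeta>|\<^sup>2 - \<kappa> |\<zeta>|\<^sup>2\<close>. Moving \<open>\<zeta>\<close> and \<open>w\<close> simultaneously, to \<open>c + \<tau>\<close> and \<open>w + \<tau> \<phi>' c\<close>, changes
  \<open>w - \<phi> \<zeta>\<close> only by the second-order Taylor remainder, which is holomorphic and vanishes at \<open>\<tau> = 0\<close>. On
  the circle of radius \<open>r\<close> the mean of the penalty therefore grows by at most a multiple of \<open>r\<^sup>4\<close>,
  whereas the other term loses \<open>\<kappa> r\<^sup>2\<close>. For small \<open>r\<close> the loss wins, and the inequality at the centre is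
  strict.\<close>
lemma psh_strictly_below_penalised_disc:
  fixes L :: "complex \<Rightarrow> real"
  assumes u: "plurisubharmonic_on \<Omega> u" and w: "w \<in> \<Omega>"
    and A: "open A" "c \<in> A" and f: "f holomorphic_on A" and g: "g holomorphic_on A"
    and H: "open B" "c \<in> B" "H holomorphic_on B" and L: "\<And>\<zeta>. \<zeta> \<in> B \<Longrightarrow> L \<zeta> = Re (H \<zeta>)"
    and \<kappa>: "0 < \<kappa>" and N: "0 \<le> N"
    and le: "\<forall>\<^sub>F \<tau> in nhds 0. u (fst w + \<tau> * deriv f c, snd w + \<tau> * deriv g c)
               \<le> ereal (M + k * L (c + \<tau>) - \<kappa> * (cmod (c + \<tau>))\<^sup>2
                   + N * ((cmod (fst w + \<tau> * deriv f c - f (c + \<tau>)))\<^sup>2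
                        + (cmod (snd w + \<tau> * deriv g c - g (c + \<tau>)))\<^sup>2))"
  shows "u w < ereal (M + k * L c - \<kappa> * (cmod c)\<^sup>2
                   + N * ((cmod (fst w - f c))\<^sup>2 + (cmod (snd w - g c))\<^sup>2))"
proof -
  define e1 e2 where "e1 = fst w - f c" and "e2 = snd w - g c"
  define \<psi>1 where "\<psi>1 \<tau> = f (c + \<tau>) - f c - \<tau> * deriv f c" for \<tau>
  define \<psi>2 where "\<psi>2 \<tau> = g (c + \<tau>) - g c - \<tau> * deriv g c" for \<tau>
  obtain B1 where B1: "\<forall>\<^sub>F \<tau> in nhds 0. cmod (\<psi>1 \<tau>) \<le> B1 * (cmod \<tau>)\<^sup>2"
    unfolding \<psi>1_def using holomorphic_Taylor_remainder[OF f A] by blast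
  obtain B2 where B2: "\<forall>\<^sub>F \<tau> in nhds 0. cmod (\<psi>2 \<tau>) \<le> B2 * (cmod \<tau>)\<^sup>2"
    unfolding \<psi>2_def using holomorphic_Taylor_remainder[OF g A] by blast
  have small: "\<forall>\<^sub>F \<tau> in nhds (0::complex). N * (B1\<^sup>2 + B2\<^sup>2) * (cmod \<tau>)\<^sup>2 < \<kappa>"
  proof (rule order_tendstoD(2))
    show "((\<lambda>\<tau>::complex. N * (B1\<^sup>2 + B2\<^sup>2) * (cmod \<tau>)\<^sup>2) \<longlongrightarrow> N * (B1\<^sup>2 + B2\<^sup>2) * (cmod 0)\<^sup>2) (nhds 0)"
      by (intro tendsto_intros filterlim_ident)
  qed (use \<kappa> in simp)
  have lim: "((\<lambda>\<tau>. c + \<tau>) \<longlongrightarrow> c + 0) (nhds 0)"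
    by (intro tendsto_intros filterlim_ident)
  have domA: "\<forall>\<^sub>F \<tau> in nhds 0. c + \<tau> \<in> A" and domB: "\<forall>\<^sub>F \<tau> in nhds 0. c + \<tau> \<in> B"
    using topological_tendstoD[OF lim] A H by auto
  have "open \<Omega>" using u by (simp add: plurisubharmonic_on_def)
  moreover have "((\<lambda>\<tau>. (fst w + \<tau> * deriv f c, snd w + \<tau> * deriv g c)) \<longlongrightarrow>
      (fst w + 0 * deriv f c, snd w + 0 * deriv g c)) (nhds 0)"
    by (intro tendsto_intros filterlim_ident)
  ultimately have dom\<Omega>: "\<forall>\<^sub>F \<tau> in nhds 0. (fst w + \<tau> * deriv f c, snd w + \<tau> * deriv g c) \<in> \<Omega>"
    using w by (intro topological_tendstoD) auto
  have "\<forall>\<^sub>F \<tau> in nhds 0. cmod (\<psi>1 \<tau>) \<le> B1 * (cmod \<tau>)\<^sup>2 \<and> cmod (\<psi>2 \<tau>) \<le> B2 * (cmod \<tau>)\<^sup>2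
     \<and> N * (B1\<^sup>2 + B2\<^sup>2) * (cmod \<tau>)\<^sup>2 < \<kappa> \<and> c + \<tau> \<in> A \<and> c + \<tau> \<in> B
     \<and> (fst w + \<tau> * deriv f c, snd w + \<tau> * deriv g c) \<in> \<Omega>
     \<and> u (fst w + \<tau> * deriv f c, snd w + \<tau> * deriv g c)
               \<le> ereal (M + k * L (c + \<tau>) - \<kappa> * (cmod (c + \<tau>))\<^sup>2
                   + N * ((cmod (fst w + \<tau> * deriv f c - f (c + \<tau>)))\<^sup>2
                        + (cmod (snd w + \<tau> * deriv g c - g (c + \<tau>)))\<^sup>2))"
    by (intro eventually_conj B1 B2 small domA domB dom\<Omega> le)
  then obtain d where d: "d > 0" "\<And>\<tau>. dist \<tau> 0 < d \<Longrightarrow>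
      cmod (\<psi>1 \<tau>) \<le> B1 * (cmod \<tau>)\<^sup>2 \<and> cmod (\<psi>2 \<tau>) \<le> B2 * (cmod \<tau>)\<^sup>2
     \<and> N * (B1\<^sup>2 + B2\<^sup>2) * (cmod \<tau>)\<^sup>2 < \<kappa> \<and> c + \<tau> \<in> A \<and> c + \<tau> \<in> B
     \<and> (fst w + \<tau> * deriv f c, snd w + \<tau> * deriv g c) \<in> \<Omega>
     \<and> u (fst w + \<tau> * deriv f c, snd w + \<tau> * deriv g c)
               \<le> ereal (M + k * L (c + \<tau>) - \<kappa> * (cmod (c + \<tau>))\<^sup>2
                   + N * ((cmod (fst w + \<tau> * deriv f c - f (c + \<tau>)))\<^sup>2
                        + (cmod (snd w + \<tau> * deriv g c - g (c + \<tau>)))\<^sup>2))"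
    unfolding eventually_nhds_metric by blast
  define r where "r = d / 2"
  have r: "0 < r" "r < d" using d by (auto simp: r_def)
  \<comment> \<open>On the circle the majorant of \<open>u\<close> is at most \<open>Re (F \<tau>) + K\<close>: the cross terms of both squared norms are real parts of holomorphic functions.\<close>
  define F where "F \<tau> = of_real k * H (c + \<tau>) - of_real (2 * \<kappa>) * (cnj c * \<tau>)
      - of_real (2 * N) * (cnj e1 * \<psi>1 \<tau> + cnj e2 * \<psi>2 \<tau>)" for \<tau>
  define K where "K = M - \<kappa> * (cmod c)\<^sup>2 + N * ((cmod e1)\<^sup>2 + (cmod e2)\<^sup>2)
      - r\<^sup>2 * (\<kappa> - N * (B1\<^sup>2 + B2\<^sup>2) * r\<^sup>2)"
  have "u w \<le> ereal (Re (F 0) + K)"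
  proof (rule psh_le_Re_holomorphic_on_line[OF u r(1), where q = "(deriv f c, deriv g c)"
        and A = "ball 0 d"])
    show "(fst w + \<tau> * fst (deriv f c, deriv g c), snd w + \<tau> * snd (deriv f c, deriv g c)) \<in> \<Omega>"
      if "cmod \<tau> \<le> r" for \<tau>
      using d(2)[of \<tau>] that r by (simp add: dist_norm)
    have "c + \<tau> \<in> A \<and> c + \<tau> \<in> B" if "\<tau> \<in> ball 0 d" for \<tau>
      using d(2)[of \<tau>] that by (simp add: dist_commute)
    then have maps: "(\<lambda>\<tau>. c + \<tau>) ` ball 0 d \<subseteq> A" "(\<lambda>\<tau>. c + \<tau>) ` ball 0 d \<subseteq> B"
      by blast+
    have hc: "(\<lambda>\<tau>. c + \<tau>) holomorphic_on ball 0 d"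
      by (intro holomorphic_intros)
    have "(\<lambda>\<tau>. f (c + \<tau>)) holomorphic_on ball 0 d" "(\<lambda>\<tau>. g (c + \<tau>)) holomorphic_on ball 0 d"
      "(\<lambda>\<tau>. H (c + \<tau>)) holomorphic_on ball 0 d"
      using holomorphic_on_compose_gen[OF hc f maps(1)] holomorphic_on_compose_gen[OF hc g maps(1)]
        holomorphic_on_compose_gen[OF hc H(3) maps(2)]
      by (simp_all add: o_def)
    then show "F holomorphic_on ball 0 d"
      unfolding F_def \<psi>1_def \<psi>2_def by (intro holomorphic_intros)
    show "cball 0 r \<subseteq> ball (0::complex) d" using r by auto
    fix \<tau> assume \<tau>: "cmod \<tau> = r"
    note D = d(2)[of \<tau>, unfolded dist_norm diff_0_right \<tau>, OF r(2)]
    have shift: "fst w + \<tau> * deriv f c - f (c + \<tau>) = e1 - \<psi>1 \<tau>"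
      "snd w + \<tau> * deriv g c - g (c + \<tau>) = e2 - \<psi>2 \<tau>"
      by (simp_all add: e1_def e2_def \<psi>1_def \<psi>2_def)
    have "(cmod (c + \<tau>))\<^sup>2 = (cmod c)\<^sup>2 + 2 * Re (cnj c * \<tau>) + r\<^sup>2"
      using cmod_diff_squared[of c "-\<tau>"] \<tau> by simp
    moreover have "(cmod (\<psi>1 \<tau>))\<^sup>2 + (cmod (\<psi>2 \<tau>))\<^sup>2 \<le> (B1 * r\<^sup>2)\<^sup>2 + (B2 * r\<^sup>2)\<^sup>2"
      using D by (intro add_mono power_mono) auto
    then have "N * ((cmod (\<psi>1 \<tau>))\<^sup>2 + (cmod (\<psi>2 \<tau>))\<^sup>2) \<le> N * ((B1 * r\<^sup>2)\<^sup>2 + (B2 * r\<^sup>2)\<^sup>2)"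
      using N by (rule mult_left_mono)
    ultimately have "M + k * L (c + \<tau>) - \<kappa> * (cmod (c + \<tau>))\<^sup>2
        + N * ((cmod (e1 - \<psi>1 \<tau>))\<^sup>2 + (cmod (e2 - \<psi>2 \<tau>))\<^sup>2) \<le> Re (F \<tau>) + K"
      using D L[of "c + \<tau>"] unfolding cmod_diff_squared F_def K_def
      by (simp add: algebra_simps power2_eq_square)
    moreover have "u (fst w + \<tau> * deriv f c, snd w + \<tau> * deriv g c)
       \<le> ereal (M + k * L (c + \<tau>) - \<kappa> * (cmod (c + \<tau>))\<^sup>2
                   + N * ((cmod (e1 - \<psi>1 \<tau>))\<^sup>2 + (cmod (e2 - \<psi>2 \<tau>))\<^sup>2))"
      using D unfolding shift by blast
    ultimately show "u (fst w + \<tau> * fst (deriv f c, deriv g c), snd w + \<tau> * snd (deriv f c, deriv g c))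
          \<le> ereal (Re (F \<tau>) + K)"
      by (simp only: fst_conv snd_conv) (meson ereal_less_eq(3) order_trans)
  qed auto
  also have "Re (F 0) + K < M + k * L c - \<kappa> * (cmod c)\<^sup>2 + N * ((cmod e1)\<^sup>2 + (cmod e2)\<^sup>2)"
  proof -
    have "N * (B1\<^sup>2 + B2\<^sup>2) * r\<^sup>2 < \<kappa>"
      using d(2)[of "of_real r"] r by (simp add: dist_norm)
    then have "r\<^sup>2 * (\<kappa> - N * (B1\<^sup>2 + B2\<^sup>2) * r\<^sup>2) > 0"
      using r by simp
    then show ?thesis
      using L[OF H(2)] by (simp add: F_def K_def \<psi>1_def \<psi>2_def)
  qed
  finally show ?thesis by (simp add: e1_def e2_def)
qed

text \<open>This would follow from the maximum principle for \<open>u \<circ> \<phi>\<close>, if plurisubharmonic functions were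
  known to restrict to subharmonic functions on holomorphic discs and not just on complex lines. The
  direct proof doubles the variables. If the bound failed at \<open>\<zeta>\<^sub>0\<close>, maximise
  \<open>u w - (1 - \<kappa>) L \<zeta> + \<kappa> (|\<zeta>|\<^sup>2 - R\<^sup>2) - N |w - \<phi> \<zeta>|\<^sup>2\<close>
  over the pairs with \<open>|\<zeta>| \<le> R\<close>, \<open>|\<zeta> - a| \<ge> s\<close> for every pole parameter \<open>a\<close>, and \<open>|w - \<phi> \<zeta>| \<le> t\<close>. The maximum
  is positive. It is not on \<open>|\<zeta>| = R\<close>, where \<open>L \<ge> 0\<close>; nor on \<open>|\<zeta> - a| = s\<close>, where the weakened pole
  dominates \<open>u\<close>; nor on \<open>|w - \<phi> \<zeta>| = t\<close>, where the penalty is large. An interior maximum is excluded by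
  the preceding strict inequality.

  Dividing by \<open>R - \<eta>\<close> instead of using Blaschke factors makes \<open>L\<close> nonnegative on the boundary circle, and
  costs nothing in the limit \<open>\<eta> \<rightarrow> 0\<close>.\<close>
lemma psh_le_log_sum_on_disc:
  assumes u: "u \<in> psh_nonpos \<Omega>"
    and A: "open A" "cball 0 R \<subseteq> A" and f: "f holomorphic_on A" and g: "g holomorphic_on A"
    and into: "\<And>\<zeta>. cmod \<zeta> \<le> R \<Longrightarrow> (f \<zeta>, g \<zeta>) \<in> \<Omega>"
    and J: "finite J" "\<And>a. a \<in> J \<Longrightarrow> cmod a \<le> \<eta>" "\<eta> < R"
    and pole: "\<And>a. a \<in> J \<Longrightarrow> log_pole u (f a, g a)"
    and \<zeta>0: "cmod \<zeta>\<^sub>0 < R" "\<zeta>\<^sub>0 \<notin> J"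
  shows "u (f \<zeta>\<^sub>0, g \<zeta>\<^sub>0) \<le> ereal (\<Sum>a\<in>J. ln (cmod (\<zeta>\<^sub>0 - a) / (R - \<eta>)))"
proof (rule ccontr)
  define L where "L \<zeta> = (\<Sum>a\<in>J. ln (cmod (\<zeta> - a) / (R - \<eta>)))" for \<zeta>
  assume "\<not> ?thesis"
  then have "ereal (L \<zeta>\<^sub>0) < u (f \<zeta>\<^sub>0, g \<zeta>\<^sub>0)"
    by (simp add: L_def)
  then obtain m where m: "L \<zeta>\<^sub>0 < m" "ereal m < u (f \<zeta>\<^sub>0, g \<zeta>\<^sub>0)"
    using ereal_dense2 by (metis ereal_less(2) less_ereal.simps(1))
  have psh: "plurisubharmonic_on \<Omega> u" and nonpos: "\<And>w. w \<in> \<Omega> \<Longrightarrow> u w \<le> 0"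
    using u by (auto simp: psh_nonpos_def)
  then have \<Omega>: "open \<Omega>" "usc_on \<Omega> u" "\<And>w. w \<in> \<Omega> \<Longrightarrow> u w < \<infinity>"
    by (auto simp: plurisubharmonic_on_def)
  define q where "q = 2 * (1 + \<bar>L \<zeta>\<^sub>0\<bar> + R\<^sup>2)"
  define \<kappa> where "\<kappa> = min (1/2) ((m - L \<zeta>\<^sub>0) / q)"
  have q: "q > 0" by (simp add: q_def add_pos_nonneg)
  have \<kappa>: "0 < \<kappa>" "\<kappa> < 1"
    using m q by (auto simp: \<kappa>_def)
  have "\<kappa> * q \<le> m - L \<zeta>\<^sub>0"
    using q by (simp add: \<kappa>_def flip: pos_le_divide_eq)
  moreover have "\<kappa> * (2 * (R\<^sup>2 - L \<zeta>\<^sub>0)) \<le> \<kappa> * q"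
    using \<kappa> zero_le_power2[of R] unfolding q_def by (intro mult_left_mono) linarith+
  ultimately have gap: "m - (1 - \<kappa>) * L \<zeta>\<^sub>0 - \<kappa> * R\<^sup>2 > 0"
    using m(1) by (simp add: algebra_simps)

  \<comment> \<open>\<open>s\<close>: radius of the discs removed around the pole parameters\<close>
  have "\<forall>\<^sub>F s in at_right 0. \<forall>\<zeta> w. cmod (\<zeta> - a) = s \<longrightarrow> norm (w - (f \<zeta>, g \<zeta>)) \<le> s
           \<longrightarrow> u w < ereal ((1 - \<kappa>) * L \<zeta>)" if a: "a \<in> J" for a
  proof (rule pole_dominated_by_weaker_pole[where f = f and g = g and a = a, OF psh pole[OF a]])
    have a_R: "cmod a \<le> R" using J a by force
    then show "(f a, g a) \<in> \<Omega>" by (rule into)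
    have "a \<in> A" using a_R A by auto
    then show "(f has_field_derivative deriv f a) (at a)" "(g has_field_derivative deriv g a) (at a)"
      using f g A by (auto intro: holomorphic_derivI)
    let ?l = "\<lambda>\<zeta>. (\<Sum>b\<in>J - {a}. ln (cmod (\<zeta> - b) / (R - \<eta>))) - ln (R - \<eta>)"
    show "L \<zeta> = ln (cmod (\<zeta> - a)) + ?l \<zeta>" if "\<zeta> \<noteq> a" for \<zeta>
      using that J a by (simp add: L_def sum.remove[OF J(1) a] ln_div)
    show "isCont ?l a"
      using J by (intro continuous_intros) auto
  qed (use \<kappa> in auto)
  then have "\<forall>\<^sub>F s in at_right 0. \<forall>a\<in>J. \<forall>\<zeta> w. cmod (\<zeta> - a) = s \<longrightarrow> norm (w - (f \<zeta>, g \<zeta>)) \<le> s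
           \<longrightarrow> u w < ereal ((1 - \<kappa>) * L \<zeta>)"
    using J(1) by (simp add: eventually_ball_finite)
  moreover have "\<forall>\<^sub>F s in at_right 0. \<forall>a\<in>J. s \<in> {0<..<cmod (\<zeta>\<^sub>0 - a)}"
    using J(1) \<zeta>0 by (intro eventually_ball_finite ballI eventually_at_right_real) auto
  moreover have "\<forall>\<^sub>F s in at_right (0::real). 0 < s"
    by (rule eventually_at_right_less)
  ultimately have "\<forall>\<^sub>F s in at_right 0. 0 < s \<and> (\<forall>a\<in>J. s < cmod (\<zeta>\<^sub>0 - a)) \<and>
      (\<forall>a\<in>J. \<forall>\<zeta> w. cmod (\<zeta> - a) = s \<longrightarrow> norm (w - (f \<zeta>, g \<zeta>)) \<le> s
           \<longrightarrow> u w < ereal ((1 - \<kappa>) * L \<zeta>))"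
    by eventually_elim auto
  then have "\<exists>s>0. (\<forall>a\<in>J. s < cmod (\<zeta>\<^sub>0 - a)) \<and>
      (\<forall>a\<in>J. \<forall>\<zeta> w. cmod (\<zeta> - a) = s \<longrightarrow> norm (w - (f \<zeta>, g \<zeta>)) \<le> s
           \<longrightarrow> u w < ereal ((1 - \<kappa>) * L \<zeta>))"
    by (rule eventually_happens'[OF trivial_limit_at_right_real])
  then obtain s where s: "0 < s" "\<And>a. a \<in> J \<Longrightarrow> s < cmod (\<zeta>\<^sub>0 - a)"
    "\<forall>a\<in>J. \<forall>\<zeta> w. cmod (\<zeta> - a) = s \<longrightarrow> norm (w - (f \<zeta>, g \<zeta>)) \<le> s
           \<longrightarrow> u w < ereal ((1 - \<kappa>) * L \<zeta>)"
    by blast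

  \<comment> \<open>\<open>t\<close>: radius of the tube around the disc\<close>
  have cont: "continuous_on (cball 0 R) f" "continuous_on (cball 0 R) g"
    using f g A by (auto intro: holomorphic_on_imp_continuous_on holomorphic_on_subset)
  have "compact ((\<lambda>\<zeta>. (f \<zeta>, g \<zeta>)) ` cball 0 R)"
    by (intro compact_continuous_image continuous_intros cont) auto
  moreover have "(\<lambda>\<zeta>. (f \<zeta>, g \<zeta>)) ` cball 0 R \<subseteq> \<Omega>"
    using into by auto
  ultimately obtain t0 where t0: "t0 > 0" "(\<Union>x\<in>(\<lambda>\<zeta>. (f \<zeta>, g \<zeta>)) ` cball 0 R. cball x t0) \<subseteq> \<Omega>"
    using compact_subset_open_imp_cball_epsilon_subset[OF _ \<Omega>(1)] by metis
  define t where "t = min s t0"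
  have t: "0 < t" "t \<le> s" "t \<le> t0" using s t0 by (auto simp: t_def)
  \<comment> \<open>A pair is stored as \<open>(\<zeta>, w - \<phi> \<zeta>)\<close>, so that the tube is a product of compact sets.\<close>
  define p where "p = (\<lambda>x. (f (fst x), g (fst x)) + snd x)"
  define Lmin where "Lmin = of_nat (card J) * ln (s / (R - \<eta>))"
  \<comment> \<open>\<open>Lmin\<close> bounds \<open>L\<close> from below outside the removed discs; \<open>N\<close> makes the penalty on the wall of the tube outweigh it.\<close>
  define N where "N = (\<bar>Lmin\<bar> + 1) / t\<^sup>2"
  have N: "N \<ge> 0" "N * t\<^sup>2 = \<bar>Lmin\<bar> + 1" using t by (auto simp: N_def)
  define h where "h = (\<lambda>x. - ((1 - \<kappa>) * L (fst x)) + \<kappa> * ((cmod (fst x))\<^sup>2 - R\<^sup>2) - N * (norm (snd x :: complex \<times> complex))\<^sup>2)"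
  define Z where "Z = cball 0 R \<inter> (\<Inter>a\<in>J. {\<zeta>. s \<le> cmod (\<zeta> - a)})"
  define K where "K = Z \<times> cball (0 :: complex \<times> complex) t"
  have in_\<Omega>: "p x \<in> \<Omega>" if "x \<in> K" for x
  proof -
    have "norm (snd x) \<le> t0"
      using that t by (simp add: K_def mem_Times_iff)
    then have "p x \<in> cball (f (fst x), g (fst x)) t0"
      by (simp add: p_def dist_norm)
    moreover have "fst x \<in> cball 0 R"
      using that by (auto simp: K_def Z_def)
    ultimately show ?thesis
      using t0(2) by blast
  qed
  have Z_cont: "continuous_on Z f" "continuous_on Z g"
    using cont by (auto simp: Z_def intro: continuous_on_subset)
  have "a \<notin> Z" if "a \<in> J" for a
    using that s(1) by (force simp: Z_def)
  then have L_cont: "continuous_on Z L"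
    unfolding L_def using J by (intro continuous_intros) auto
  have fst_K: "fst ` K \<subseteq> Z" by (auto simp: K_def)
  have "continuous_on K p"
    unfolding p_def by (intro continuous_intros continuous_on_compose2[OF Z_cont(1) _ fst_K]
        continuous_on_compose2[OF Z_cont(2) _ fst_K])
  moreover have "continuous_on K h"
    unfolding h_def by (intro continuous_intros continuous_on_compose2[OF L_cont _ fst_K])
  ultimately have "usc_on K (\<lambda>x. u (p x) + ereal (h x))"
    using in_\<Omega> \<Omega> by (intro usc_on_comp_add_continuous[of \<Omega>]) auto
  moreover have "compact K"
    unfolding K_def Z_def
    by (intro compact_Times compact_Int_closed compact_cball closed_INT ballI closed_Collect_le continuous_intros)
  moreover have x0: "(\<zeta>\<^sub>0, 0) \<in> K"
    using \<zeta>0 s t by (auto simp: K_def Z_def less_imp_le)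
  ultimately obtain x where x: "x \<in> K" "\<And>y. y \<in> K \<Longrightarrow> u (p y) + ereal (h y) \<le> u (p x) + ereal (h x)"
    using usc_on_attains_sup[of K "\<lambda>x. u (p x) + ereal (h x)"] by blast
  obtain c e where x_eq: "x = (c, e)" by (cases x)
  have p_x: "p x = (f c, g c) + e" by (simp add: p_def x_eq)

  have "h (\<zeta>\<^sub>0, 0) = \<kappa> * (cmod \<zeta>\<^sub>0)\<^sup>2 - (1 - \<kappa>) * L \<zeta>\<^sub>0 - \<kappa> * R\<^sup>2"
    by (simp add: h_def algebra_simps)
  moreover have "0 \<le> \<kappa> * (cmod \<zeta>\<^sub>0)\<^sup>2"
    using \<kappa> by simp
  ultimately have "0 < m + h (\<zeta>\<^sub>0, 0)"
    using gap by linarith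
  also have "ereal (m + h (\<zeta>\<^sub>0, 0)) \<le> u (p (\<zeta>\<^sub>0, 0)) + ereal (h (\<zeta>\<^sub>0, 0))"
    using m(2) by (simp add: p_def flip: plus_ereal.simps) (intro add_right_mono less_imp_le)
  also have "\<dots> \<le> u (p x) + ereal (h x)"
    using x x0 by blast
  finally have pos: "0 < u (p x) + ereal (h x)" by (simp add: zero_ereal_def)
  have ux: "u (p x) \<le> 0" using nonpos in_\<Omega> x by blast
  then obtain U where U: "u (p x) = ereal U" "U \<le> 0" "0 < U + h x"
    using pos by (cases "u (p x)") auto

  \<comment> \<open>the maximum point lies in the interior, as the value there is positive\<close>
  have c: "cmod c \<le> R" "\<And>a. a \<in> J \<Longrightarrow> s \<le> cmod (c - a)" and e: "norm e \<le> t"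
    using x(1) by (auto simp: x_eq K_def Z_def)
  have \<kappa>c: "\<kappa> * ((cmod c)\<^sup>2 - R\<^sup>2) \<le> 0"
    using power_mono[OF c(1), of 2] \<kappa> by (intro mult_nonneg_nonpos) auto
  have Ne: "0 \<le> N * (norm e)\<^sup>2" using N by simp
  have "cmod c < R"
  proof (rule ccontr)
    assume "\<not> cmod c < R"
    then have "R - \<eta> \<le> cmod (c - a)" if "a \<in> J" for a
      using J(2)[OF that] norm_triangle_ineq2[of c a] by simp
    then have "0 \<le> L c"
      using J(3) unfolding L_def by (intro sum_nonneg) auto
    then have "0 \<le> (1 - \<kappa>) * L c"
      using \<kappa> by simp
    then have "h x \<le> 0"
      using \<kappa>c Ne unfolding h_def x_eq fst_conv snd_conv by linarith
    with U show False by simp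
  qed
  moreover have "norm e < t"
  proof (rule ccontr)
    assume "\<not> norm e < t"
    with e have "norm e = t" by simp
    have "ln (s / (R - \<eta>)) \<le> ln (cmod (c - a) / (R - \<eta>))" if "a \<in> J" for a
      using c(2)[OF that] s J(3) by (intro ln_mono divide_right_mono) auto
    then have "Lmin \<le> L c"
      unfolding Lmin_def L_def by (intro sum_bounded_below)
    then have "(1 - \<kappa>) * (- L c) \<le> (1 - \<kappa>) * \<bar>Lmin\<bar>"
      using \<kappa> by (intro mult_left_mono) auto
    also have "\<dots> \<le> \<bar>Lmin\<bar>"
      using \<kappa> by (simp add: mult_left_le_one_le)
    finally have "h x < 0"
      using \<kappa>c N \<open>norm e = t\<close> unfolding h_def x_eq fst_conv snd_conv by simp
    with U show False by simp
  qed
  moreover have "s < cmod (c - a)" if a: "a \<in> J" for a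
  proof (rule ccontr)
    assume "\<not> s < cmod (c - a)"
    with c(2)[OF a] have "cmod (c - a) = s" by simp
    moreover have "norm (p x - (f c, g c)) \<le> s"
      using e t by (simp add: p_x)
    ultimately have "u (p x) < ereal ((1 - \<kappa>) * L c)"
      by (rule s(3)[rule_format, OF a])
    with U \<kappa>c Ne show False
      unfolding h_def x_eq fst_conv snd_conv by simp
  qed
  ultimately have int: "cmod c < R" "norm e < t" "\<And>a. a \<in> J \<Longrightarrow> s < cmod (c - a)"
    by blast+
  have "c \<in> A" using int A by auto
  have "c \<notin> J" using int(3)[of c] s by auto
  then obtain H B where H: "open B" "c \<in> B" "H holomorphic_on B" "\<forall>\<zeta>\<in>B. L \<zeta> = Re (H \<zeta>)"
    using log_sum_locally_Re_holomorphic[OF J(1), of c "R - \<eta>"] J(3) unfolding L_def by auto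
  define E where "E \<tau> = (fst (p x) + \<tau> * deriv f c - f (c + \<tau>), snd (p x) + \<tau> * deriv g c - g (c + \<tau>))" for \<tau>
  have "u (p x) < ereal ((U + h x + \<kappa> * R\<^sup>2) + (1 - \<kappa>) * L c - \<kappa> * (cmod c)\<^sup>2
                   + N * ((cmod (fst (p x) - f c))\<^sup>2 + (cmod (snd (p x) - g c))\<^sup>2))"
  proof (rule psh_strictly_below_penalised_disc[OF psh _ A(1) \<open>c \<in> A\<close> f g H(1-3) H(4)[rule_format] \<kappa>(1) N(1)])
    show "p x \<in> \<Omega>" using in_\<Omega> x by blast
    have "((\<lambda>\<tau>. c + \<tau>) \<longlongrightarrow> c + 0) (nhds 0)"
      by (intro tendsto_intros filterlim_ident)
    then have idt: "((\<lambda>\<tau>. c + \<tau>) \<longlongrightarrow> c) (nhds 0)" by simp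
    have "isCont f c" "isCont g c"
      using f g A \<open>c \<in> A\<close> by (auto intro: continuous_on_interior holomorphic_on_imp_continuous_on simp: interior_open)
    then have fg: "((\<lambda>\<tau>. f (c + \<tau>)) \<longlongrightarrow> f c) (nhds 0)" "((\<lambda>\<tau>. g (c + \<tau>)) \<longlongrightarrow> g c) (nhds 0)"
      using idt isCont_tendsto_compose by blast+
    have "(E \<longlongrightarrow> (fst (p x) + 0 * deriv f c - f c, snd (p x) + 0 * deriv g c - g c)) (nhds 0)"
      unfolding E_def by (intro tendsto_intros fg filterlim_ident)
    moreover have "(fst (p x) + 0 * deriv f c - f c, snd (p x) + 0 * deriv g c - g c) = e"
      by (simp add: p_x prod_eq_iff)
    ultimately have "(E \<longlongrightarrow> e) (nhds 0)" by simp
    then have "\<forall>\<^sub>F \<tau> in nhds 0. norm (E \<tau>) < t"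
      using int(2) by (intro order_tendstoD(2)[OF tendsto_norm])
    moreover have "\<forall>\<^sub>F \<tau> in nhds 0. cmod (c + \<tau>) < R"
      using int(1) by (intro order_tendstoD(2)[OF tendsto_norm[OF idt]])
    moreover have "\<forall>\<^sub>F \<tau> in nhds 0. \<forall>a\<in>J. s < cmod (c + \<tau> - a)"
      using int(3) J(1)
      by (intro eventually_ball_finite ballI order_tendstoD(1)[OF tendsto_norm[OF tendsto_diff[OF idt tendsto_const]]])
    ultimately show "\<forall>\<^sub>F \<tau> in nhds 0. u (fst (p x) + \<tau> * deriv f c, snd (p x) + \<tau> * deriv g c)
               \<le> ereal ((U + h x + \<kappa> * R\<^sup>2) + (1 - \<kappa>) * L (c + \<tau>) - \<kappa> * (cmod (c + \<tau>))\<^sup>2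
                   + N * ((cmod (fst (p x) + \<tau> * deriv f c - f (c + \<tau>)))\<^sup>2
                        + (cmod (snd (p x) + \<tau> * deriv g c - g (c + \<tau>)))\<^sup>2))"
    proof eventually_elim
      case (elim \<tau>)
      then have "(c + \<tau>, E \<tau>) \<in> K"
        by (auto simp: K_def Z_def)
      then have "u (p (c + \<tau>, E \<tau>)) + ereal (h (c + \<tau>, E \<tau>)) \<le> ereal (U + h x)"
        using x(2) U by fastforce
      moreover have "p (c + \<tau>, E \<tau>) = (fst (p x) + \<tau> * deriv f c, snd (p x) + \<tau> * deriv g c)"
        by (simp add: p_def E_def)
      ultimately have "u (fst (p x) + \<tau> * deriv f c, snd (p x) + \<tau> * deriv g c)
          \<le> ereal (U + h x - h (c + \<tau>, E \<tau>))"
        by (cases "u (fst (p x) + \<tau> * deriv f c, snd (p x) + \<tau> * deriv g c)") auto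
      moreover have "(norm (E \<tau>))\<^sup>2 = (cmod (fst (p x) + \<tau> * deriv f c - f (c + \<tau>)))\<^sup>2
                        + (cmod (snd (p x) + \<tau> * deriv g c - g (c + \<tau>)))\<^sup>2"
        by (simp add: norm_prod_squared E_def)
      then have "U + h x - h (c + \<tau>, E \<tau>) = (U + h x + \<kappa> * R\<^sup>2) + (1 - \<kappa>) * L (c + \<tau>) - \<kappa> * (cmod (c + \<tau>))\<^sup>2
                   + N * ((cmod (fst (p x) + \<tau> * deriv f c - f (c + \<tau>)))\<^sup>2
                        + (cmod (snd (p x) + \<tau> * deriv g c - g (c + \<tau>)))\<^sup>2)"
        by (simp add: h_def algebra_simps)
      ultimately show ?case by simp
    qed
  qed
  also have "(U + h x + \<kappa> * R\<^sup>2) + (1 - \<kappa>) * L c - \<kappa> * (cmod c)\<^sup>2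
                   + N * ((cmod (fst (p x) - f c))\<^sup>2 + (cmod (snd (p x) - g c))\<^sup>2) = U"
  proof -
    have "(norm e)\<^sup>2 = (cmod (fst (p x) - f c))\<^sup>2 + (cmod (snd (p x) - g c))\<^sup>2"
      by (simp add: norm_prod_squared p_x)
    then show ?thesis
      by (simp add: h_def x_eq algebra_simps)
  qed
  finally show False using U by simp
qed

section \<open>Green functions and families of discs\<close>

text \<open>Each of the \<open>n\<close> pole parameters tends to the centre of a disc of radius \<open>R\<close> and contributes
  \<open>ln (1 / R)\<close> at the parameter 1, at which all discs pass through \<open>(z\<^sub>1, z\<^sub>2)\<close>.\<close>
lemma Limsup_green_le_of_discs:
  fixes f g :: "'a \<Rightarrow> complex \<Rightarrow> complex" and J :: "'a \<Rightarrow> complex set"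
  assumes R: "1 < R"
    and disc: "\<forall>\<^sub>F \<epsilon> in F. f \<epsilon> holomorphic_on UNIV \<and> g \<epsilon> holomorphic_on UNIV
        \<and> (\<forall>\<zeta>. cmod \<zeta> \<le> R \<longrightarrow> (f \<epsilon> \<zeta>, g \<epsilon> \<zeta>) \<in> \<Omega>) \<and> f \<epsilon> 1 = z\<^sub>1 \<and> g \<epsilon> 1 = z\<^sub>2"
    and poles: "\<forall>\<^sub>F \<epsilon> in F. finite (J \<epsilon>) \<and> card (J \<epsilon>) = n \<and> (\<forall>a\<in>J \<epsilon>. (f \<epsilon> a, g \<epsilon> a) \<in> S \<epsilon>)"
    and small: "\<And>\<eta>::real. \<eta> > 0 \<Longrightarrow> \<forall>\<^sub>F \<epsilon> in F. \<forall>a\<in>J \<epsilon>. cmod a \<le> \<eta>"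
  shows "Limsup F (\<lambda>\<epsilon>. pluricomplex_green \<Omega> (S \<epsilon>) (z\<^sub>1, z\<^sub>2)) \<le> ereal (- (real n * ln R))"
proof (rule ereal_le_epsilon2)
  fix e :: real assume e: "e > 0"
  have "((\<lambda>\<eta>. real n * ln ((1 + \<eta>) / (R - \<eta>))) \<longlongrightarrow> real n * ln ((1 + 0) / (R - 0))) (at_right 0)"
    using R by (intro tendsto_intros) auto
  moreover have "real n * ln ((1 + 0) / (R - 0)) < - (real n * ln R) + e"
    using R e by (simp add: ln_div)
  ultimately have "\<forall>\<^sub>F \<eta> in at_right 0. real n * ln ((1 + \<eta>) / (R - \<eta>)) < - (real n * ln R) + e"
    by (rule order_tendstoD(2))
  moreover have "\<forall>\<^sub>F \<eta> in at_right 0. \<eta> \<in> {0<..<(1::real)}"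
    by (intro eventually_at_right_real) auto
  ultimately have "\<forall>\<^sub>F \<eta> in at_right 0. real n * ln ((1 + \<eta>) / (R - \<eta>)) < - (real n * ln R) + e
      \<and> \<eta> \<in> {0<..<(1::real)}"
    by (rule eventually_conj)
  then have "\<exists>\<eta>. real n * ln ((1 + \<eta>) / (R - \<eta>)) < - (real n * ln R) + e \<and> \<eta> \<in> {0<..<(1::real)}"
    by (rule eventually_happens'[OF trivial_limit_at_right_real])
  then obtain \<eta> where \<eta>: "real n * ln ((1 + \<eta>) / (R - \<eta>)) < - (real n * ln R) + e" "0 < \<eta>" "\<eta> < 1"
    by auto
  have "\<forall>\<^sub>F \<epsilon> in F. pluricomplex_green \<Omega> (S \<epsilon>) (z\<^sub>1, z\<^sub>2) \<le> ereal (- (real n * ln R) + e)"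
    using disc poles small[OF \<eta>(2)]
  proof eventually_elim
    case (elim \<epsilon>)
    have bound: "u (z\<^sub>1, z\<^sub>2) \<le> ereal (- (real n * ln R) + e)"
      if u: "u \<in> psh_nonpos \<Omega>" "\<forall>a\<in>S \<epsilon>. log_pole u a" for u
    proof -
      have "1 \<notin> J \<epsilon>" using elim \<eta> by force
      then have "u (f \<epsilon> 1, g \<epsilon> 1) \<le> ereal (\<Sum>a\<in>J \<epsilon>. ln (cmod (1 - a) / (R - \<eta>)))"
        using elim u \<eta> R
        by (intro psh_le_log_sum_on_disc[where A = UNIV and \<Omega> = \<Omega>]) auto
      also have "(\<Sum>a\<in>J \<epsilon>. ln (cmod (1 - a) / (R - \<eta>))) \<le> (\<Sum>a\<in>J \<epsilon>. ln ((1 + \<eta>) / (R - \<eta>)))"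
      proof (rule sum_mono)
        fix a assume a: "a \<in> J \<epsilon>"
        with elim have "cmod (1 - a) \<le> 1 + \<eta>"
          using norm_triangle_ineq4[of 1 a] by force
        moreover have "cmod (1 - a) > 0" using a \<open>1 \<notin> J \<epsilon>\<close> by auto
        ultimately show "ln (cmod (1 - a) / (R - \<eta>)) \<le> ln ((1 + \<eta>) / (R - \<eta>))"
          using R \<eta> by (intro ln_mono divide_right_mono) auto
      qed
      also have "\<dots> = real n * ln ((1 + \<eta>) / (R - \<eta>))"
        using elim by simp
      also note less_imp_le[OF \<eta>(1)]
      finally show ?thesis using elim by simp
    qed
    then show ?case
      unfolding pluricomplex_green_def by (intro SUP_least) auto
  qed
  then have "Limsup F (\<lambda>\<epsilon>. pluricomplex_green \<Omega> (S \<epsilon>) (z\<^sub>1, z\<^sub>2)) \<le> ereal (- (real n * ln R) + e)"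
    by (rule Limsup_bounded)
  then show "Limsup F (\<lambda>\<epsilon>. pluricomplex_green \<Omega> (S \<epsilon>) (z\<^sub>1, z\<^sub>2)) \<le> ereal (- (real n * ln R)) + ereal e"
    by simp
qed

section \<open>Parabolas through the three poles\<close>

text \<open>The discs are \<open>\<zeta> \<mapsto> (s \<zeta> + (z\<^sub>1 - s) W \<zeta>, z\<^sub>2 W \<zeta>)\<close> with
  \<open>W \<zeta> = \<zeta> (\<zeta> - \<epsilon>/s) / (1 - \<epsilon>/s)\<close>. For every \<open>s\<close> other than 0 and \<open>\<epsilon>\<close> they pass through \<open>(0, 0)\<close>, \<open>(\<epsilon>, 0)\<close> and \<open>(z\<^sub>1, z\<^sub>2)\<close> at the
  parameters 0, \<open>\<epsilon>/s\<close> and 1. They meet \<open>(\<rho>, \<delta> \<rho>)\<close> at \<open>\<zeta>\<close> if and only if \<open>W \<zeta> = k \<rho>\<close> with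
  \<open>k = \<delta>/z\<^sub>2\<close> and \<open>s \<zeta> = \<rho> (1 - k (z\<^sub>1 - s))\<close>. Eliminating \<open>\<zeta>\<close> leaves a quadratic equation for \<open>s\<close>.\<close>
lemma third_pole_on_parabola:
  fixes k \<epsilon> \<rho> z s :: complex
  defines "X \<equiv> 1 - k * (z - s)"
  assumes s: "s \<noteq> 0" "s \<noteq> \<epsilon>" and k: "k \<noteq> 0"
    and quad: "k * s\<^sup>2 * (1 - k * \<rho>) = 2 * k * \<rho> * (1 - k * z) * s + (1 - k * z) * (\<rho> * (1 - k * z) - \<epsilon>)"
  shows "(\<rho> * X / s) * (\<rho> * X / s - \<epsilon> / s) / (1 - \<epsilon> / s) = k * \<rho>"
proof -
  have eq: "X * (\<rho> * X - \<epsilon>) = k * (s * (s - \<epsilon>))"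
    using quad unfolding X_def by algebra
  have "(\<rho> * X / s) * (\<rho> * X / s - \<epsilon> / s) / (1 - \<epsilon> / s) = \<rho> * (X * (\<rho> * X - \<epsilon>)) / (s * (s - \<epsilon>))"
    using s by (simp add: divide_simps)
  also have "\<dots> = k * \<rho>"
    using s by (simp add: eq)
  finally show ?thesis .
qed

text \<open>The discriminant \<open>D\<close> has the size of \<open>\<epsilon>/k\<close>, because \<open>\<rho> - \<epsilon>\<close> is comparable to \<open>\<epsilon>\<close>. So a root \<open>s\<close> of size
  \<open>sqrt |\<epsilon>/k|\<close> exists. It tends to 0 since \<open>k\<close> dominates \<open>\<epsilon>\<close>, and \<open>\<epsilon>/s\<close>, of size \<open>sqrt |\<epsilon> k|\<close>, tends to
  0 since \<open>k\<close> does.\<close>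
lemma quadratic_root_asymptotics:
  fixes \<epsilon> \<rho> k :: "'a \<Rightarrow> complex"
  assumes \<epsilon>: "(\<epsilon> \<longlongrightarrow> 0) F" and k: "(k \<longlongrightarrow> 0) F" and \<epsilon>k: "((\<lambda>x. \<epsilon> x / k x) \<longlongrightarrow> 0) F"
    and nz: "\<forall>\<^sub>F x in F. \<epsilon> x \<noteq> 0 \<and> k x \<noteq> 0"
    and \<rho>: "\<forall>\<^sub>F x in F. cmod (\<rho> x) \<le> cmod (\<epsilon> x)"
    and far: "\<forall>\<^sub>F x in F. cmod (\<epsilon> x) / 4 \<le> cmod (\<rho> x - \<epsilon> x)"
  obtains s where "(s \<longlongrightarrow> 0) F" "((\<lambda>x. \<epsilon> x / s x) \<longlongrightarrow> 0) F"
    "\<forall>\<^sub>F x in F. s x \<noteq> 0 \<and> s x \<noteq> \<epsilon> x \<and>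
       k x * (s x)\<^sup>2 * (1 - k x * \<rho> x) = 2 * k x * \<rho> x * (1 - k x * z) * s x
         + (1 - k x * z) * (\<rho> x * (1 - k x * z) - \<epsilon> x)"
proof -
  define X where "X x = 1 - k x * z" for x
  define a where "a x = 1 - k x * \<rho> x" for x
  define y where "y x = \<rho> x * X x - \<epsilon> x" for x
  define D where "D x = (\<rho> x * X x)\<^sup>2 + a x * X x * (y x / k x)" for x
  define s where "s x = (\<rho> x * X x + csqrt (D x)) / a x" for x
  have \<rho>0: "(\<rho> \<longlongrightarrow> 0) F"
    using \<rho> tendsto_norm_zero[OF \<epsilon>] by (rule Lim_null_comparison)
  have "(X \<longlongrightarrow> 1 - 0 * z) F" unfolding X_def by (intro tendsto_intros k)
  then have X: "(X \<longlongrightarrow> 1) F" by simp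
  have "(a \<longlongrightarrow> 1 - 0 * 0) F" unfolding a_def by (intro tendsto_intros k \<rho>0)
  then have a: "(a \<longlongrightarrow> 1) F" by simp
  have "\<forall>\<^sub>F x in F. cmod (\<rho> x / k x) \<le> cmod (\<epsilon> x / k x)"
    using \<rho> by eventually_elim (simp add: norm_divide divide_right_mono)
  then have \<rho>k: "((\<lambda>x. \<rho> x / k x) \<longlongrightarrow> 0) F"
    using tendsto_norm_zero[OF \<epsilon>k] by (rule Lim_null_comparison)
  have "((\<lambda>x. (\<rho> x * X x)\<^sup>2 + a x * X x * ((\<rho> x / k x) * X x - \<epsilon> x / k x)) \<longlongrightarrow>
      (0 * 1)\<^sup>2 + 1 * 1 * (0 * 1 - 0)) F"
    by (intro tendsto_intros \<rho>0 X a \<rho>k \<epsilon>k)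
  then have D: "(D \<longlongrightarrow> 0) F"
    by (simp add: D_def[abs_def] y_def diff_divide_distrib)
  have sqD: "((\<lambda>x. csqrt (D x)) \<longlongrightarrow> 0) F"
    using tendsto_real_sqrt[OF tendsto_norm_zero[OF D]]
    by (intro tendsto_norm_zero_cancel[of "\<lambda>x. csqrt (D x)"]) (simp add: norm_csqrt)

  \<comment> \<open>Lower bound for \<open>D\<close>: in \<open>k D = a X y + k \<rho>\<^sup>2 X\<^sup>2\<close> the first term dominates, since \<open>y\<close> is close to \<open>\<rho> - \<epsilon>\<close>.\<close>
  have "((\<lambda>x. (k x * \<rho> x) * (X x)\<^sup>2) \<longlongrightarrow> (0 * 0) * 1\<^sup>2) F"
    by (intro tendsto_intros k \<rho>0 X)
  then have "\<forall>\<^sub>F x in F. cmod ((k x * \<rho> x) * (X x)\<^sup>2) < 1/32"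
    by (intro order_tendstoD(2)[OF tendsto_norm_zero]) auto
  moreover have "\<forall>\<^sub>F x in F. cmod (a x * X x) > 1/2"
    using tendsto_norm[OF tendsto_mult[OF a X]] by (rule order_tendstoD) simp
  moreover have "\<forall>\<^sub>F x in F. cmod (k x * z) < 1/8"
    using tendsto_norm_zero[OF tendsto_mult_left_zero[OF k, of z]] by (rule order_tendstoD) simp
  ultimately have low: "\<forall>\<^sub>F x in F. cmod (\<epsilon> x) / 32 \<le> cmod (k x * D x)"
    using nz \<rho> far
  proof eventually_elim
    case (elim x)
    have "\<rho> x - \<epsilon> x = y x + \<rho> x * (k x * z)"
      by (simp add: y_def X_def algebra_simps)
    then have "cmod (\<rho> x - \<epsilon> x) \<le> cmod (y x) + cmod (\<rho> x) * cmod (k x * z)"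
      using norm_triangle_ineq[of "y x" "\<rho> x * (k x * z)"] by (simp add: norm_mult)
    moreover have "cmod (\<rho> x) * cmod (k x * z) \<le> cmod (\<epsilon> x) * (1/8)"
      using elim by (intro mult_mono) auto
    ultimately have y: "cmod (\<epsilon> x) / 8 \<le> cmod (y x)"
      using elim by linarith
    have "(1/2) * (cmod (\<epsilon> x) / 8) \<le> cmod (a x * X x) * cmod (y x)"
      using elim y by (intro mult_mono) auto
    moreover have "cmod (\<rho> x) * cmod ((k x * \<rho> x) * (X x)\<^sup>2) \<le> cmod (\<epsilon> x) * (1/32)"
      using elim by (intro mult_mono) auto
    moreover have "k x * D x = a x * X x * y x + \<rho> x * ((k x * \<rho> x) * (X x)\<^sup>2)"
      using elim by (simp add: D_def field_simps power2_eq_square)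
    then have "cmod (a x * X x) * cmod (y x) - cmod (\<rho> x) * cmod ((k x * \<rho> x) * (X x)\<^sup>2) \<le> cmod (k x * D x)"
      using norm_diff_ineq[of "a x * X x * y x" "\<rho> x * ((k x * \<rho> x) * (X x)\<^sup>2)"] by (simp add: norm_mult)
    ultimately show ?case by linarith
  qed
  have D0: "\<forall>\<^sub>F x in F. D x \<noteq> 0"
    using low nz by eventually_elim auto
  have "\<forall>\<^sub>F x in F. cmod ((\<epsilon> x)\<^sup>2 / D x) \<le> 32 * cmod (k x * \<epsilon> x)"
    using low nz D0
  proof eventually_elim
    case (elim x)
    then have "(32 * cmod (\<epsilon> x)) * (cmod (\<epsilon> x) / 32) \<le> (32 * cmod (\<epsilon> x)) * (cmod (k x) * cmod (D x))"
      by (intro mult_left_mono) (auto simp: norm_mult)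
    with elim show ?case
      by (simp add: norm_divide norm_mult norm_power field_simps power2_eq_square)
  qed
  moreover have "((\<lambda>x. 32 * cmod (k x * \<epsilon> x)) \<longlongrightarrow> 32 * cmod (0 * 0)) F"
    by (intro tendsto_intros k \<epsilon>)
  ultimately have "((\<lambda>x. (\<epsilon> x)\<^sup>2 / D x) \<longlongrightarrow> 0) F"
    using Lim_null_comparison by force
  from tendsto_real_sqrt[OF tendsto_norm_zero[OF this]]
  have \<epsilon>D: "((\<lambda>x. \<epsilon> x / csqrt (D x)) \<longlongrightarrow> 0) F"
    by (intro tendsto_norm_zero_cancel[of "\<lambda>x. \<epsilon> x / csqrt (D x)"])
       (simp add: norm_divide norm_power real_sqrt_divide norm_csqrt)
  have "\<forall>\<^sub>F x in F. cmod (\<rho> x / csqrt (D x)) \<le> cmod (\<epsilon> x / csqrt (D x))"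
    using \<rho> by eventually_elim (simp add: norm_divide divide_right_mono)
  then have \<rho>D: "((\<lambda>x. \<rho> x / csqrt (D x)) \<longlongrightarrow> 0) F"
    using tendsto_norm_zero[OF \<epsilon>D] by (rule Lim_null_comparison)
  have den: "((\<lambda>x. \<rho> x / csqrt (D x) * X x + 1) \<longlongrightarrow> 0 * 1 + 1) F"
    by (intro tendsto_intros \<rho>D X)
  have den0: "\<forall>\<^sub>F x in F. \<rho> x / csqrt (D x) * X x + 1 \<noteq> 0"
    using tendsto_imp_eventually_ne[OF den] by simp
  have a0: "\<forall>\<^sub>F x in F. a x \<noteq> 0"
    using tendsto_imp_eventually_ne[OF a] by simp
  \<comment> \<open>The square root is the dominant part of \<open>s\<close>.\<close>
  have s_eq: "\<forall>\<^sub>F x in F. s x = csqrt (D x) * (\<rho> x / csqrt (D x) * X x + 1) / a x"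
    using D0
  proof eventually_elim
    case (elim x)
    then have "csqrt (D x) \<noteq> 0" by simp
    then have "\<rho> x * X x + csqrt (D x) = csqrt (D x) * (\<rho> x / csqrt (D x) * X x + 1)"
      by (simp add: distrib_left)
    then show ?case by (simp add: s_def)
  qed
  have s0: "\<forall>\<^sub>F x in F. s x \<noteq> 0"
    using s_eq D0 den0 a0 by eventually_elim simp
  have "(s \<longlongrightarrow> (0 * 1 + 0) / 1) F"
    unfolding s_def by (intro tendsto_intros \<rho>0 X sqD a) simp
  then have s_lim: "(s \<longlongrightarrow> 0) F" by simp
  have "((\<lambda>x. a x * (\<epsilon> x / csqrt (D x)) / (\<rho> x / csqrt (D x) * X x + 1)) \<longlongrightarrow> 1 * 0 / (0 * 1 + 1)) F"
    by (intro tendsto_divide[OF _ den] tendsto_mult a \<epsilon>D) simp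
  moreover have "\<forall>\<^sub>F x in F. a x * (\<epsilon> x / csqrt (D x)) / (\<rho> x / csqrt (D x) * X x + 1) = \<epsilon> x / s x"
    using s_eq by eventually_elim simp
  ultimately have \<epsilon>s: "((\<lambda>x. \<epsilon> x / s x) \<longlongrightarrow> 0) F"
    using Lim_transform_eventually by force
  have "\<forall>\<^sub>F x in F. \<epsilon> x / s x \<noteq> 1"
    by (rule tendsto_imp_eventually_ne[OF \<epsilon>s]) simp
  then have "\<forall>\<^sub>F x in F. s x \<noteq> 0 \<and> s x \<noteq> \<epsilon> x \<and>
       k x * (s x)\<^sup>2 * (1 - k x * \<rho> x) = 2 * k x * \<rho> x * (1 - k x * z) * s x
         + (1 - k x * z) * (\<rho> x * (1 - k x * z) - \<epsilon> x)"
    using s0 a0 nz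
  proof eventually_elim
    case (elim x)
    have "csqrt (D x) = a x * s x - \<rho> x * X x"
      using elim by (simp add: s_def)
    then have "D x = (a x * s x - \<rho> x * X x)\<^sup>2"
      by (metis power2_csqrt)
    then have "a x * (k x * (a x * (s x)\<^sup>2 - 2 * \<rho> x * X x * s x) - X x * y x) = 0"
      using elim by (simp add: D_def field_simps power2_eq_square)
    then have "k x * (a x * (s x)\<^sup>2 - 2 * \<rho> x * X x * s x) = X x * y x"
      using elim by simp
    then show ?case
      using elim by (auto simp: X_def a_def y_def algebra_simps)
  qed
  with s_lim \<epsilon>s show thesis by (rule that)
qed

section \<open>The upper bound\<close>

text \<open>On the axis through the first two poles these two suffice: the line itself is a disc, and
  it gives the smaller bound \<open>2 ln |z|\<close> in the limit \<open>R \<rightarrow> 1 / |z|\<close>.\<close>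
lemma Limsup_green_le_on_axis:
  fixes S :: "complex \<Rightarrow> (complex \<times> complex) set"
  assumes z: "z \<noteq> 0" and R: "1 < R" "cmod z * R < 1"
    and S: "\<forall>\<^sub>F \<epsilon> in at 0 within E. {(0, 0), (\<epsilon>, 0)} \<subseteq> S \<epsilon>"
  shows "Limsup (at 0 within E) (\<lambda>\<epsilon>. pluricomplex_green bidisk (S \<epsilon>) (z, 0)) \<le> ereal (- (2 * ln R))"
proof -
  have "Limsup (at 0 within E) (\<lambda>\<epsilon>. pluricomplex_green bidisk (S \<epsilon>) (z, 0)) \<le> ereal (- (real 2 * ln R))"
  proof (rule Limsup_green_le_of_discs[where f = "\<lambda>_ \<zeta>. z * \<zeta>" and g = "\<lambda>_ _. 0" and J = "\<lambda>\<epsilon>. {0, \<epsilon> / z}"])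
    have "cmod z * cmod \<zeta> < 1" if "cmod \<zeta> \<le> R" for \<zeta>
      using mult_left_mono[OF that, of "cmod z"] R(2) by simp
    then show "\<forall>\<^sub>F \<epsilon> in at 0 within E. (\<lambda>\<zeta>. z * \<zeta>) holomorphic_on UNIV \<and> (\<lambda>_. 0) holomorphic_on UNIV
        \<and> (\<forall>\<zeta>. cmod \<zeta> \<le> R \<longrightarrow> (z * \<zeta>, 0) \<in> bidisk) \<and> z * 1 = z \<and> (0::complex) = 0"
      by (intro always_eventually) (auto simp: bidisk_def norm_mult intro!: holomorphic_intros)
    show "\<forall>\<^sub>F \<epsilon> in at 0 within E. finite {0, \<epsilon> / z} \<and> card {0, \<epsilon> / z} = 2
        \<and> (\<forall>a\<in>{0, \<epsilon> / z}. (z * a, 0) \<in> S \<epsilon>)"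
      using S eventually_neq_at_within[of 0 0 E]
      by eventually_elim (use z in auto)
    fix \<eta> :: real assume \<eta>: "\<eta> > 0"
    have "((\<lambda>\<epsilon>. cmod (\<epsilon> / z)) \<longlongrightarrow> cmod (0 / z)) (at 0 within E)"
      using z by (intro tendsto_intros)
    then have "\<forall>\<^sub>F \<epsilon> in at 0 within E. cmod (\<epsilon> / z) < \<eta>"
      using \<eta> by (intro order_tendstoD(2)) auto
    then show "\<forall>\<^sub>F \<epsilon> in at 0 within E. \<forall>a\<in>{0, \<epsilon> / z}. cmod a \<le> \<eta>"
      by eventually_elim (use \<eta> in auto)
  qed (use R in auto)
  then show ?thesis by simp
qed

text \<open>The parabolas converge to \<open>\<zeta> \<mapsto> \<zeta>\<^sup>2 (z\<^sub>1, z\<^sub>2)\<close>, so they map the disc of radius \<open>R\<close> into the bidisk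
  as soon as \<open>R\<^sup>2 max (|z\<^sub>1|, |z\<^sub>2|) < 1\<close>. The exponent 3/2 of the final estimate is the quotient of three
  poles by the order 2 of this limit at 0.\<close>
lemma Limsup_green_le_off_axis:
  fixes E :: "complex set" and S :: "complex \<Rightarrow> (complex \<times> complex) set" and \<rho> \<delta> :: "complex \<Rightarrow> complex"
  assumes z: "z\<^sub>2 \<noteq> 0" and R: "1 < R" "cmod z\<^sub>1 * R\<^sup>2 < 1" "cmod z\<^sub>2 * R\<^sup>2 < 1"
    and \<delta>: "(\<delta> \<longlongrightarrow> 0) (at 0 within E)"
    and \<epsilon>\<delta>: "((\<lambda>\<epsilon>. \<epsilon> / \<delta> \<epsilon>) \<longlongrightarrow> 0) (at 0 within E)"
    and nz: "\<forall>\<^sub>F \<epsilon> in at 0 within E. \<delta> \<epsilon> \<noteq> 0 \<and> \<rho> \<epsilon> \<noteq> 0"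
    and \<rho>: "\<forall>\<^sub>F \<epsilon> in at 0 within E. cmod (\<rho> \<epsilon>) \<le> cmod \<epsilon>"
    and far: "\<forall>\<^sub>F \<epsilon> in at 0 within E. cmod \<epsilon> / 4 \<le> cmod (\<rho> \<epsilon> - \<epsilon>)"
    and S: "\<forall>\<^sub>F \<epsilon> in at 0 within E. {(0, 0), (\<epsilon>, 0), (\<rho> \<epsilon>, \<delta> \<epsilon> * \<rho> \<epsilon>)} \<subseteq> S \<epsilon>"
  shows "Limsup (at 0 within E) (\<lambda>\<epsilon>. pluricomplex_green bidisk (S \<epsilon>) (z\<^sub>1, z\<^sub>2)) \<le> ereal (- (3 * ln R))"
proof -
  let ?F = "at 0 within E"
  have \<epsilon>_nz: "\<forall>\<^sub>F \<epsilon> in ?F. \<epsilon> \<noteq> 0"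
    by (rule eventually_neq_at_within)
  have k: "((\<lambda>\<epsilon>. \<delta> \<epsilon> / z\<^sub>2) \<longlongrightarrow> 0) ?F"
    using tendsto_divide[OF \<delta> tendsto_const[of z\<^sub>2]] z by simp
  have \<epsilon>k: "((\<lambda>\<epsilon>. \<epsilon> / (\<delta> \<epsilon> / z\<^sub>2)) \<longlongrightarrow> 0) ?F"
    using tendsto_mult[OF \<epsilon>\<delta> tendsto_const[of z\<^sub>2]] by simp
  have k_nz: "\<forall>\<^sub>F \<epsilon> in ?F. \<epsilon> \<noteq> 0 \<and> \<delta> \<epsilon> / z\<^sub>2 \<noteq> 0"
    using nz \<epsilon>_nz by eventually_elim (use z in auto)
  obtain s where s: "(s \<longlongrightarrow> 0) ?F" "((\<lambda>\<epsilon>. \<epsilon> / s \<epsilon>) \<longlongrightarrow> 0) ?F"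
    and quad: "\<forall>\<^sub>F \<epsilon> in ?F. s \<epsilon> \<noteq> 0 \<and> s \<epsilon> \<noteq> \<epsilon> \<and>
       (\<delta> \<epsilon> / z\<^sub>2) * (s \<epsilon>)\<^sup>2 * (1 - (\<delta> \<epsilon> / z\<^sub>2) * \<rho> \<epsilon>) = 2 * (\<delta> \<epsilon> / z\<^sub>2) * \<rho> \<epsilon> * (1 - (\<delta> \<epsilon> / z\<^sub>2) * z\<^sub>1) * s \<epsilon>
         + (1 - (\<delta> \<epsilon> / z\<^sub>2) * z\<^sub>1) * (\<rho> \<epsilon> * (1 - (\<delta> \<epsilon> / z\<^sub>2) * z\<^sub>1) - \<epsilon>)"
    by (rule quadratic_root_asymptotics[where \<epsilon> = "\<lambda>\<epsilon>. \<epsilon>" and z = z\<^sub>1, OF _ k \<epsilon>k k_nz \<rho> far])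
       (rule tendsto_ident_at)
  define \<tau> where "\<tau> \<epsilon> = \<epsilon> / s \<epsilon>" for \<epsilon>
  define X where "X \<epsilon> = 1 - (\<delta> \<epsilon> / z\<^sub>2) * (z\<^sub>1 - s \<epsilon>)" for \<epsilon>
  define \<sigma> where "\<sigma> \<epsilon> = \<rho> \<epsilon> * X \<epsilon> / s \<epsilon>" for \<epsilon>
  define W where "W \<epsilon> \<zeta> = \<zeta> * (\<zeta> - \<tau> \<epsilon>) / (1 - \<tau> \<epsilon>)" for \<epsilon> \<zeta>
  define f where "f \<epsilon> \<zeta> = s \<epsilon> * \<zeta> + (z\<^sub>1 - s \<epsilon>) * W \<epsilon> \<zeta>" for \<epsilon> \<zeta>
  define g where "g \<epsilon> \<zeta> = z\<^sub>2 * W \<epsilon> \<zeta>" for \<epsilon> \<zeta>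
  have \<tau>: "(\<tau> \<longlongrightarrow> 0) ?F"
    using s(2) by (simp add: \<tau>_def[abs_def])
  have "\<forall>\<^sub>F \<epsilon> in ?F. cmod (\<rho> \<epsilon> / s \<epsilon>) \<le> cmod (\<epsilon> / s \<epsilon>)"
    using \<rho> by eventually_elim (simp add: norm_divide divide_right_mono)
  then have \<rho>s: "((\<lambda>\<epsilon>. \<rho> \<epsilon> / s \<epsilon>) \<longlongrightarrow> 0) ?F"
    using tendsto_norm_zero[OF s(2)] by (rule Lim_null_comparison)
  have "((\<lambda>\<epsilon>. \<rho> \<epsilon> / s \<epsilon> * (1 - (\<delta> \<epsilon> / z\<^sub>2) * (z\<^sub>1 - s \<epsilon>))) \<longlongrightarrow> 0 * (1 - 0 * (z\<^sub>1 - 0))) ?F"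
    by (intro tendsto_intros \<rho>s k s)
  then have \<sigma>: "(\<sigma> \<longlongrightarrow> 0) ?F"
    by (simp add: \<sigma>_def[abs_def] X_def)

  have \<tau>1: "\<forall>\<^sub>F \<epsilon> in ?F. \<tau> \<epsilon> \<noteq> 1"
    by (rule tendsto_imp_eventually_ne[OF \<tau>]) simp
  have "((\<lambda>\<epsilon>. R * (R + cmod (\<tau> \<epsilon>)) / cmod (1 - \<tau> \<epsilon>)) \<longlongrightarrow> R * (R + cmod 0) / cmod (1 - 0)) ?F"
    by (intro tendsto_intros \<tau>) auto
  then have Q: "((\<lambda>\<epsilon>. R * (R + cmod (\<tau> \<epsilon>)) / cmod (1 - \<tau> \<epsilon>)) \<longlongrightarrow> R\<^sup>2) ?F"
    by (simp add: power2_eq_square)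
  have W_bound: "cmod (W \<epsilon> \<zeta>) \<le> R * (R + cmod (\<tau> \<epsilon>)) / cmod (1 - \<tau> \<epsilon>)" if "cmod \<zeta> \<le> R" for \<epsilon> \<zeta>
  proof -
    have "cmod (\<zeta> - \<tau> \<epsilon>) \<le> R + cmod (\<tau> \<epsilon>)"
      using norm_triangle_ineq4[of \<zeta> "\<tau> \<epsilon>"] that by simp
    then show ?thesis
      using that R unfolding W_def norm_divide norm_mult
      by (intro divide_right_mono mult_mono) auto
  qed
  have "((\<lambda>\<epsilon>. cmod (s \<epsilon>) * R + cmod (z\<^sub>1 - s \<epsilon>) * (R * (R + cmod (\<tau> \<epsilon>)) / cmod (1 - \<tau> \<epsilon>)))
      \<longlongrightarrow> cmod 0 * R + cmod (z\<^sub>1 - 0) * R\<^sup>2) ?F"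
    by (intro tendsto_intros Q s)
  then have f_small: "\<forall>\<^sub>F \<epsilon> in ?F. cmod (s \<epsilon>) * R + cmod (z\<^sub>1 - s \<epsilon>) * (R * (R + cmod (\<tau> \<epsilon>)) / cmod (1 - \<tau> \<epsilon>)) < 1"
    using R by (intro order_tendstoD(2)) auto
  have g_small: "\<forall>\<^sub>F \<epsilon> in ?F. cmod z\<^sub>2 * (R * (R + cmod (\<tau> \<epsilon>)) / cmod (1 - \<tau> \<epsilon>)) < 1"
    by (rule order_tendstoD(2)[OF tendsto_mult[OF tendsto_const Q] R(3)])

  have "Limsup ?F (\<lambda>\<epsilon>. pluricomplex_green bidisk (S \<epsilon>) (z\<^sub>1, z\<^sub>2)) \<le> ereal (- (real 3 * ln R))"
  proof (rule Limsup_green_le_of_discs[where f = f and g = g and J = "\<lambda>\<epsilon>. {0, \<tau> \<epsilon>, \<sigma> \<epsilon>}"])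
    show "\<forall>\<^sub>F \<epsilon> in ?F. f \<epsilon> holomorphic_on UNIV \<and> g \<epsilon> holomorphic_on UNIV
        \<and> (\<forall>\<zeta>. cmod \<zeta> \<le> R \<longrightarrow> (f \<epsilon> \<zeta>, g \<epsilon> \<zeta>) \<in> bidisk) \<and> f \<epsilon> 1 = z\<^sub>1 \<and> g \<epsilon> 1 = z\<^sub>2"
      using f_small g_small \<tau>1
    proof eventually_elim
      case (elim \<epsilon>)
      have "W \<epsilon> holomorphic_on UNIV"
        unfolding W_def using elim by (intro holomorphic_intros) auto
      then have "f \<epsilon> holomorphic_on UNIV" "g \<epsilon> holomorphic_on UNIV"
        unfolding f_def g_def by (auto intro!: holomorphic_intros)
      moreover have "W \<epsilon> 1 = 1" using elim by (simp add: W_def)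
      moreover have "(f \<epsilon> \<zeta>, g \<epsilon> \<zeta>) \<in> bidisk" if \<zeta>: "cmod \<zeta> \<le> R" for \<zeta>
      proof -
        have "cmod (f \<epsilon> \<zeta>) \<le> cmod (s \<epsilon>) * cmod \<zeta> + cmod (z\<^sub>1 - s \<epsilon>) * cmod (W \<epsilon> \<zeta>)"
          unfolding f_def norm_mult[symmetric] by (rule norm_triangle_ineq)
        also have "\<dots> \<le> cmod (s \<epsilon>) * R + cmod (z\<^sub>1 - s \<epsilon>) * (R * (R + cmod (\<tau> \<epsilon>)) / cmod (1 - \<tau> \<epsilon>))"
          by (intro add_mono mult_left_mono W_bound \<zeta>) auto
        finally have "cmod (f \<epsilon> \<zeta>) < 1" using elim by linarith
        moreover have "cmod (g \<epsilon> \<zeta>) \<le> cmod z\<^sub>2 * (R * (R + cmod (\<tau> \<epsilon>)) / cmod (1 - \<tau> \<epsilon>))"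
          unfolding g_def norm_mult by (intro mult_left_mono W_bound \<zeta>) auto
        then have "cmod (g \<epsilon> \<zeta>) < 1"
          using elim by linarith
        ultimately show ?thesis by (simp add: bidisk_def)
      qed
      ultimately show ?case by (simp add: f_def g_def)
    qed
    show "\<forall>\<^sub>F \<epsilon> in ?F. finite {0, \<tau> \<epsilon>, \<sigma> \<epsilon>} \<and> card {0, \<tau> \<epsilon>, \<sigma> \<epsilon>} = 3
        \<and> (\<forall>a\<in>{0, \<tau> \<epsilon>, \<sigma> \<epsilon>}. (f \<epsilon> a, g \<epsilon> a) \<in> S \<epsilon>)"
      using quad nz \<epsilon>_nz S
    proof eventually_elim
      case (elim \<epsilon>)
      have "W \<epsilon> (\<sigma> \<epsilon>) = (\<delta> \<epsilon> / z\<^sub>2) * \<rho> \<epsilon>"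
        unfolding W_def \<sigma>_def X_def \<tau>_def
        using elim z by (intro third_pole_on_parabola) auto
      moreover have "s \<epsilon> * \<sigma> \<epsilon> = \<rho> \<epsilon> - (z\<^sub>1 - s \<epsilon>) * ((\<delta> \<epsilon> / z\<^sub>2) * \<rho> \<epsilon>)"
      proof -
        have "s \<epsilon> * \<sigma> \<epsilon> = \<rho> \<epsilon> * X \<epsilon>"
          using elim by (simp add: \<sigma>_def)
        then show ?thesis by (simp add: X_def algebra_simps)
      qed
      ultimately have \<sigma>_val: "f \<epsilon> (\<sigma> \<epsilon>) = \<rho> \<epsilon>" "g \<epsilon> (\<sigma> \<epsilon>) = \<delta> \<epsilon> * \<rho> \<epsilon>"
        using z by (simp_all add: f_def g_def)
      have \<tau>_val: "f \<epsilon> (\<tau> \<epsilon>) = \<epsilon>" "g \<epsilon> (\<tau> \<epsilon>) = 0"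
        using elim by (simp_all add: f_def g_def W_def \<tau>_def)
      have zero_val: "f \<epsilon> 0 = 0" "g \<epsilon> 0 = 0"
        by (simp_all add: f_def g_def W_def)
      have "\<tau> \<epsilon> \<noteq> 0" "\<sigma> \<epsilon> \<noteq> 0" "\<sigma> \<epsilon> \<noteq> \<tau> \<epsilon>"
        using zero_val \<tau>_val \<sigma>_val elim by (metis, metis mult_eq_0_iff, metis mult_eq_0_iff)
      then show ?case
        using elim zero_val \<tau>_val \<sigma>_val by auto
    qed
    fix \<eta> :: real assume \<eta>: "\<eta> > 0"
    have "\<forall>\<^sub>F \<epsilon> in ?F. cmod (\<tau> \<epsilon>) < \<eta>" "\<forall>\<^sub>F \<epsilon> in ?F. cmod (\<sigma> \<epsilon>) < \<eta>"
      using order_tendstoD(2)[OF tendsto_norm_zero[OF \<tau>] \<eta>] order_tendstoD(2)[OF tendsto_norm_zero[OF \<sigma>] \<eta>] .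
    then show "\<forall>\<^sub>F \<epsilon> in ?F. \<forall>a\<in>{0, \<tau> \<epsilon>, \<sigma> \<epsilon>}. cmod a \<le> \<eta>"
      by eventually_elim (use \<eta> in auto)
  qed (use R in auto)
  then show ?thesis by simp
qed

theorem proposition1p7:
  fixes E :: "complex set"
    and \<rho> \<delta> :: "complex \<Rightarrow> complex"
    and a\<^sub>1 a\<^sub>2 a\<^sub>3 :: "complex \<Rightarrow> complex \<times> complex"
    and S :: "complex \<Rightarrow> (complex \<times> complex) set"
    and z\<^sub>1 z\<^sub>2 :: complex
  assumes "E \<subseteq> - {0}" and "0 \<in> closure E"
    and "\<And>\<epsilon>. \<epsilon> \<in> E \<Longrightarrow> S \<epsilon> = {a\<^sub>1 \<epsilon>, a\<^sub>2 \<epsilon>, a\<^sub>3 \<epsilon>}"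
    and "\<And>\<epsilon>. \<epsilon> \<in> E \<Longrightarrow> S \<epsilon> \<subseteq> bidisk"
    and "\<And>\<epsilon>. \<epsilon> \<in> E \<Longrightarrow> a\<^sub>1 \<epsilon> = (0, 0)"
    and "\<And>\<epsilon>. \<epsilon> \<in> E \<Longrightarrow> a\<^sub>2 \<epsilon> = (\<epsilon>, 0)"
    and "\<And>\<epsilon>. \<epsilon> \<in> E \<Longrightarrow> a\<^sub>3 \<epsilon> = (\<rho> \<epsilon>, \<delta> \<epsilon> * \<rho> \<epsilon>)"
    and "\<And>\<epsilon>. \<epsilon> \<in> E \<Longrightarrow> \<rho> \<epsilon> \<noteq> 0"
    and "\<And>\<epsilon>. \<epsilon> \<in> E \<Longrightarrow> a\<^sub>1 \<epsilon> \<noteq> a\<^sub>2 \<epsilon> \<and> a\<^sub>1 \<epsilon> \<noteq> a\<^sub>3 \<epsilon> \<and> a\<^sub>2 \<epsilon> \<noteq> a\<^sub>3 \<epsilon>"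
    and "\<And>\<epsilon>. \<epsilon> \<in> E \<Longrightarrow> norm (a\<^sub>3 \<epsilon>) \<le> norm (a\<^sub>3 \<epsilon> - a\<^sub>2 \<epsilon>)"
    and "\<And>\<epsilon>. \<epsilon> \<in> E \<Longrightarrow> norm (a\<^sub>3 \<epsilon> - a\<^sub>2 \<epsilon>) \<le> cmod \<epsilon>"
    and "(\<delta> \<longlongrightarrow> 0) (at 0 within E)"
    and "filterlim (\<lambda>\<epsilon>. cmod (\<delta> \<epsilon> / \<epsilon>)) at_top (at 0 within E)"
    and "((\<lambda>\<epsilon>. ln (cmod (\<delta> \<epsilon>)) / ln (cmod \<epsilon>)) \<longlongrightarrow> 0) (at 0 within E)"
    and "(z\<^sub>1, z\<^sub>2) \<in> bidisk - {(0, 0)}"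
  shows "Limsup (at 0 within E) (\<lambda>\<epsilon>. pluricomplex_green bidisk (S \<epsilon>) (z\<^sub>1, z\<^sub>2))
           \<le> ereal (3 / 2 * ln (max (cmod z\<^sub>1) (cmod z\<^sub>2)))"
proof -
  let ?F = "at 0 within E"
  define M where "M = max (cmod z\<^sub>1) (cmod z\<^sub>2)"
  have "0 < M" "M < 1"
    using assms(15) by (auto simp: M_def bidisk_def max_def)
  then have lnM: "ln M < 0" by simp
  have inE: "\<forall>\<^sub>F \<epsilon> in ?F. \<epsilon> \<in> E"
    by (simp add: eventually_at_filter)
  have poles: "\<forall>\<^sub>F \<epsilon> in ?F. {(0, 0), (\<epsilon>, 0), (\<rho> \<epsilon>, \<delta> \<epsilon> * \<rho> \<epsilon>)} \<subseteq> S \<epsilon>"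
    using inE by eventually_elim (simp add: assms(3,5,6,7))
  have "Limsup ?F (\<lambda>\<epsilon>. pluricomplex_green bidisk (S \<epsilon>) (z\<^sub>1, z\<^sub>2)) \<le> ereal (3 / 2 * ln M)"
  proof (cases "z\<^sub>2 = 0")
    case True
    then have M: "M = cmod z\<^sub>1" by (simp add: M_def)
    \<comment> \<open>The exponent gives exactly the required bound, and \<open>R < 1 / M\<close> because it is smaller than 1 in modulus.\<close>
    define R where "R = exp (- (3/4) * ln M)"
    have "1 < R" using lnM by (simp add: R_def)
    moreover have "M * R = exp (ln M) * exp (- (3/4) * ln M)"
      using \<open>0 < M\<close> by (simp add: R_def)
    then have "M * R = exp (ln M + - (3/4) * ln M)"
      by (simp only: exp_add)
    then have "cmod z\<^sub>1 * R < 1" using lnM M by simp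
    moreover have "z\<^sub>1 \<noteq> 0" using M \<open>0 < M\<close> by auto
    ultimately have "Limsup ?F (\<lambda>\<epsilon>. pluricomplex_green bidisk (S \<epsilon>) (z\<^sub>1, 0)) \<le> ereal (- (2 * ln R))"
      using poles by (intro Limsup_green_le_on_axis) (auto elim: eventually_mono)
    also have "- (2 * ln R) = 3 / 2 * ln M" by (simp add: R_def)
    finally show ?thesis using True by simp
  next
    case False
    have big: "\<forall>\<^sub>F \<epsilon> in ?F. cmod (\<delta> \<epsilon> / \<epsilon>) > 0"
      using assms(13) unfolding filterlim_at_top_dense by blast
    have nz: "\<forall>\<^sub>F \<epsilon> in ?F. \<delta> \<epsilon> \<noteq> 0 \<and> \<rho> \<epsilon> \<noteq> 0"
      using big inE by eventually_elim (use assms(8) in auto)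
    have "((\<lambda>\<epsilon>. inverse (cmod (\<delta> \<epsilon> / \<epsilon>))) \<longlongrightarrow> 0) ?F"
      using assms(13) by (rule tendsto_inverse_0_at_top)
    then have \<epsilon>\<delta>: "((\<lambda>\<epsilon>. \<epsilon> / \<delta> \<epsilon>) \<longlongrightarrow> 0) ?F"
      by (intro tendsto_norm_zero_cancel[of "\<lambda>\<epsilon>. \<epsilon> / \<delta> \<epsilon>"]) (simp add: norm_divide)
    have \<rho>: "cmod (\<rho> \<epsilon>) \<le> cmod \<epsilon>" if "\<epsilon> \<in> E" for \<epsilon>
      using norm_fst_le[of "\<rho> \<epsilon>" "\<delta> \<epsilon> * \<rho> \<epsilon>"] assms(7,10,11)[OF that] by simp
    have "\<forall>\<^sub>F \<epsilon> in ?F. cmod (\<delta> \<epsilon>) < 1/4"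
      using tendsto_norm_zero[OF assms(12)] by (rule order_tendstoD) simp
    then have far: "\<forall>\<^sub>F \<epsilon> in ?F. cmod \<epsilon> / 4 \<le> cmod (\<rho> \<epsilon> - \<epsilon>)"
      using inE
    proof eventually_elim
      case (elim \<epsilon>)
      have "cmod \<epsilon> = norm (a\<^sub>2 \<epsilon>)"
        using assms(6)[OF elim(2)] by (simp add: norm_Pair)
      also have "\<dots> \<le> norm (a\<^sub>3 \<epsilon>) + norm (a\<^sub>3 \<epsilon> - a\<^sub>2 \<epsilon>)"
        using norm_triangle_ineq4[of "a\<^sub>3 \<epsilon>" "a\<^sub>3 \<epsilon> - a\<^sub>2 \<epsilon>"] by simp
      also have "\<dots> \<le> 2 * norm (a\<^sub>3 \<epsilon> - a\<^sub>2 \<epsilon>)"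
        using assms(10)[OF elim(2)] by simp
      also have "a\<^sub>3 \<epsilon> - a\<^sub>2 \<epsilon> = (\<rho> \<epsilon> - \<epsilon>, \<delta> \<epsilon> * \<rho> \<epsilon>)"
        using assms(6,7)[OF elim(2)] by simp
      also have "norm \<dots> \<le> cmod (\<rho> \<epsilon> - \<epsilon>) + cmod (\<delta> \<epsilon>) * cmod (\<rho> \<epsilon>)"
        using norm_Pair_le[of "\<rho> \<epsilon> - \<epsilon>" "\<delta> \<epsilon> * \<rho> \<epsilon>"] by (simp add: norm_mult)
      also have "cmod (\<delta> \<epsilon>) * cmod (\<rho> \<epsilon>) \<le> 1/4 * cmod \<epsilon>"
        using elim \<rho> by (intro mult_mono) auto
      finally show ?case by simp
    qed
    show ?thesis
    proof (rule ereal_le_epsilon2)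
      fix e :: real assume e: "0 < e"
      \<comment> \<open>\<open>R\<close> approaches \<open>1 / sqrt M\<close> from below; the second bound on \<open>t\<close> keeps \<open>R\<close> above 1.\<close>
      define t where "t = min (e / 3) (- ln M / 4)"
      define R where "R = exp (- ln M / 2 - t)"
      have t: "0 < t" "3 * t \<le> e" "t \<le> - ln M / 4"
        using e lnM by (auto simp: t_def)
      have "1 < R" using t lnM by (simp add: R_def)
      have "M * R\<^sup>2 = exp (ln M) * exp (2 * (- ln M / 2 - t))"
        unfolding R_def exp_double using \<open>0 < M\<close> by simp
      also have "\<dots> = exp (ln M + 2 * (- ln M / 2 - t))"
        by (simp only: exp_add)
      also have "\<dots> < 1" using t by simp
      finally have MR: "M * R\<^sup>2 < 1" .
      moreover have "cmod z\<^sub>1 * R\<^sup>2 \<le> M * R\<^sup>2" "cmod z\<^sub>2 * R\<^sup>2 \<le> M * R\<^sup>2"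
        by (auto simp: M_def intro!: mult_right_mono)
      ultimately have "Limsup ?F (\<lambda>\<epsilon>. pluricomplex_green bidisk (S \<epsilon>) (z\<^sub>1, z\<^sub>2)) \<le> ereal (- (3 * ln R))"
        using \<rho> inE
        by (intro Limsup_green_le_off_axis[OF False \<open>1 < R\<close> _ _ assms(12) \<epsilon>\<delta> nz _ far poles])
           (auto elim: eventually_mono)
      also have "- (3 * ln R) \<le> 3 / 2 * ln M + e"
        using t by (simp add: R_def)
      finally show "Limsup ?F (\<lambda>\<epsilon>. pluricomplex_green bidisk (S \<epsilon>) (z\<^sub>1, z\<^sub>2)) \<le> ereal (3 / 2 * ln M) + ereal e"
        by simp
    qed
  qed
  then show ?thesis by (simp only: M_def)
qed

end
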